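(* Let $k\ge0$ be an integer, and let $\mathcal{X}_n$ be the multi-parameter random complex process with $n$ vertices and multi-parameter function $(p_0(\cdot),\dots,p_{n-1}(\cdot))$, where the distribution functions $p_i$ do not depend on $n$. Suppose that there exist $u_0\in(0,1)$, $B>1$, and $D\in\bigl[0,\frac{k+2}{4(k+1)}\bigr)$ such that \[ \Phi_k(Du)\ge B\,\Psi_k(u)\quad\text{for } 0\le u\le u_0 . \] Then there exists some $c>0$ such that for every $T>\check r_k(0)$, \[ \mathbb{E}[(L_k(\mathcal{X}_n))_T]\ge c\,n^{k+1}\Phi_k(1/n)\quad\text{for all sufficiently large } n . \] In particular, $\mathbb{E}[L_k(\mathcal{X}_n)]=\Omega(n^{k+1}\Phi_k(1/n))$, i.e. $n^{k+1}\Phi_k(1/n)=O(\mathbb{E}[L_k(\mathcal{X}_n)])$ as $n\to\infty$.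
   Context: Process: let $p_0(\cdot),p_1(\cdot),\dots$ be distribution functions of non-negative random variables, independent of $n$. Let $V$ be an $n$-point set and $K(n)$ the family of all nonempty subsets of $V$. To each $\sigma\in K(n)$ of dimension $i=\#\sigma-1$ assign an independent non-negative random variable $u_\sigma$ with distribution function $p_i(\cdot)$. Put $X_n(t)=\{\sigma\in K(n): u_\tau\le t\text{ for every }\emptyset\ne\tau\subset\sigma\}$ for $t\ge0$ and $\mathcal{X}_n=\{X_n(t)\}_{t\ge0}$, a right-continuous filtration. Functions: for $t\ge 0$, $q_{-1}(t)=1$, $q_k(t)=\prod_{i=0}^k p_i(t)^{\binom{k+1}{i+1}}$ for $k\ge0$, and $r_k(t)=\prod_{i=0}^{k+1}p_i(t)^{\binom{k+1}{i}}$ for $k\ge-1$ (with $\binom00=1$). For $u<1$, $\check r_k(u)=\inf\{t\ge0: r_k(t)>u\}$. For $k\ge 0$, $Q_k(t)=\int_0^t q_k(s)\,ds$, $\Phi_k(u)=Q_k(\check r_k(u))$ and $\Psi_k(u)=Q_k(\check r_{k-1}(u))$ for $u\in[0,1)$. $\beta_k$ denotes the $k$-th reduced Betti number over $\mathbb{R}$ (homology of the augmented chain complex with $C_{-1}=\mathbb{R}$; zero for the empty complex when $k\ge0$). Lifetime sums: for a right-continuous filtration $\mathcal{X}=\{X(t)\}_{t\ge0}$ of a finite simplicial complex, the $k$-th persistent homology $\bigoplus_{t\ge 0}H_k(X(t))$ (reduced homology over $\mathbb{R}$, maps induced by inclusions), as a graded module over the ring $\mathbb{R}[\mathbb{R}_{\ge0}]$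 of finite real linear combinations of monomials $z^t$, is isomorphic to $\bigoplus_{i=1}^p (z^{b_i})/(z^{d_i})\oplus\bigoplus_{i=p+1}^{p+q}(z^{b_i})$ for unique $p,q$, birth times $b_i$ and death times $d_i>b_i$ ($d_i=\infty$ for $i>p$). Then $L_k(\mathcal{X})=\sum_{i=1}^{p+q}(d_i-b_i)=\int_0^\infty\beta_k(X(t))\,dt$, and for $T\ge0$, $(L_k(\mathcal{X}))_T=\sum_{i=1}^{p+q}(\min\{d_i,T\}-\min\{b_i,T\})=\int_0^T\beta_k(X(t))\,dt$. *)

theory Defs
  imports "HOL-Probability.Probability" "HOL-Analysis.Finite_Function_Topology"
    "HOL-Library.Set_Algebras"
begin

subsection \<open>Reduced simplicial homology over the reals\<close>

text \<open>
  A simplicial complex is a set of nonempty finite sets closed under nonempty subsets. Chains are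
  finite formal real combinations of simplices. The empty set is added as the only simplex of
  dimension \<open>-1\<close>, so the formula for \<open>boundary\<close> on a vertex is the augmentation map. Each simplex is
  oriented by the order of its vertices; the face omitting the vertex \<open>v\<close> then has the sign
  \<open>(-1)^i\<close> where \<open>i\<close> is the position of \<open>v\<close>, counted from 0.
\<close>

definition simplices :: "int \<Rightarrow> 'v set set \<Rightarrow> 'v set set" where
  "simplices k K = {\<sigma> \<in> insert {} K. int (card \<sigma>) = k + 1}"

definition chains :: "int \<Rightarrow> 'v set set \<Rightarrow> ('v set \<Rightarrow>\<^sub>0 real) set" where
  "chains k K = {c. Poly_Mapping.keys c \<subseteq> simplices k K}"

definition boundary :: "('v::linorder set \<Rightarrow>\<^sub>0 real) \<Rightarrow> ('v set \<Rightarrow>\<^sub>0 real)" where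
  "boundary c = (\<Sum>\<sigma>\<in>Poly_Mapping.keys c. \<Sum>v\<in>\<sigma>.
     Poly_Mapping.single (\<sigma> - {v}) ((-1) ^ card {w \<in> \<sigma>. w < v} * Poly_Mapping.lookup c \<sigma>))"

definition cycles :: "int \<Rightarrow> 'v::linorder set set \<Rightarrow> ('v set \<Rightarrow>\<^sub>0 real) set" where
  "cycles k K = {c \<in> chains k K. boundary c = 0}"

definition boundaries :: "int \<Rightarrow> 'v::linorder set set \<Rightarrow> ('v set \<Rightarrow>\<^sub>0 real) set" where
  "boundaries k K = boundary ` chains (k + 1) K"

text \<open>The quotient of the cycles by the boundaries, as a set of cosets.\<close>

definition homology :: "int \<Rightarrow> 'v::linorder set set \<Rightarrow> ('v set \<Rightarrow>\<^sub>0 real) set set" where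
  "homology k K = (\<lambda>z. z +o boundaries k K) ` cycles k K"


subsection \<open>Persistent homology, barcodes and lifetime sums\<close>

text \<open>
  A graded module over the ring of finite real combinations of the monomials \<open>z^t\<close>, \<open>t \<ge> 0\<close>, is
  given by its homogeneous components (real vector spaces) in the degrees \<open>t \<ge> 0\<close> and by the
  multiplications by \<open>z^s\<close>, where \<open>gshift M s t\<close> maps the component of degree \<open>t\<close> to the one of
  degree \<open>t + s\<close>. An isomorphism of graded modules is a family of linear isomorphisms of the
  components that commutes with these multiplications.
\<close>

record 'm graded_module =
  gcomp :: "real \<Rightarrow> 'm set"
  gadd :: "real \<Rightarrow> 'm \<Rightarrow> 'm \<Rightarrow> 'm"
  gscale :: "real \<Rightarrow> real \<Rightarrow> 'm \<Rightarrow> 'm"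
  gshift :: "real \<Rightarrow> real \<Rightarrow> 'm \<Rightarrow> 'm"

definition graded_isomorphic :: "'m graded_module \<Rightarrow> 'n graded_module \<Rightarrow> bool" where
  "graded_isomorphic M N \<longleftrightarrow> (\<exists>\<phi>. \<forall>t\<ge>0.
     bij_betw (\<phi> t) (gcomp M t) (gcomp N t) \<and>
     (\<forall>x\<in>gcomp M t. \<forall>y\<in>gcomp M t. \<phi> t (gadd M t x y) = gadd N t (\<phi> t x) (\<phi> t y)) \<and>
     (\<forall>a. \<forall>x\<in>gcomp M t. \<phi> t (gscale M t a x) = gscale N t a (\<phi> t x)) \<and>
     (\<forall>s\<ge>0. \<forall>x\<in>gcomp M t. \<phi> (t + s) (gshift M s t x) = gshift N s t (\<phi> t x)))"

text \<open>
  On cosets, the sum is the sum of sets. Adding the subspace of boundaries to the scalar multiple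
  makes it a coset also for the scalar 0. Likewise, the map induced by the inclusion of \<open>X t\<close> in
  \<open>X (t + s)\<close> sends the class of \<open>z\<close>, that is, \<open>z\<close> plus the boundaries in \<open>X t\<close>, to \<open>z\<close> plus the
  boundaries in \<open>X (t + s)\<close>.
\<close>

definition persistent_homology ::
  "int \<Rightarrow> (real \<Rightarrow> 'v::linorder set set) \<Rightarrow> ('v set \<Rightarrow>\<^sub>0 real) set graded_module" where
  "persistent_homology k X =
     \<lparr>gcomp = (\<lambda>t. homology k (X t)),
      gadd = (\<lambda>t x y. x + y),
      gscale = (\<lambda>t a x. (\<lambda>z. a *\<^sub>R z) ` x + boundaries k (X t)),
      gshift = (\<lambda>s t x. x + boundaries k (X (t + s)))\<rparr>"

text \<open>
  A list of pairs \<open>(b, d)\<close> stands for the direct sum of the modules \<open>(z^b)/(z^d)\<close>, and \<open>(z^b)\<close> if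
  \<open>d = \<infinity>\<close>. The component of degree \<open>t\<close> of the summand with index \<open>i\<close> is spanned by the class of
  \<open>z^t\<close>, which is nonzero iff \<open>b \<le> t < d\<close>; the coefficient of this class is the value at \<open>i\<close> of a
  finitely supported function. Multiplication by \<open>z^s\<close> keeps the coefficients of the summands that
  are still nonzero in degree \<open>t + s\<close>.
\<close>

definition alive :: "(real \<times> ereal) list \<Rightarrow> real \<Rightarrow> nat set" where
  "alive bs t = {i. i < length bs \<and> fst (bs ! i) \<le> t \<and> ereal t < snd (bs ! i)}"

definition interval_sum :: "(real \<times> ereal) list \<Rightarrow> (nat \<Rightarrow>\<^sub>0 real) graded_module" where
  "interval_sum bs =
     \<lparr>gcomp = (\<lambda>t. {c. Poly_Mapping.keys c \<subseteq> alive bs t}),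
      gadd = (\<lambda>t x y. x + y),
      gscale = (\<lambda>t a x. a *\<^sub>R x),
      gshift = (\<lambda>s t x. \<Sum>i\<in>Poly_Mapping.keys x \<inter> alive bs (t + s).
                  Poly_Mapping.single i (Poly_Mapping.lookup x i))\<rparr>"

definition is_barcode ::
  "int \<Rightarrow> (real \<Rightarrow> 'v::linorder set set) \<Rightarrow> (real \<times> ereal) list \<Rightarrow> bool" where
  "is_barcode k X bs \<longleftrightarrow> (\<forall>(b, d)\<in>set bs. 0 \<le> b \<and> ereal b < d) \<and>
     graded_isomorphic (persistent_homology k X) (interval_sum bs)"

text \<open>
  For a right-continuous filtration of a finite simplicial complex, a barcode exists and is unique
  up to the order of the list.
\<close>

definition barcode :: "int \<Rightarrow> (real \<Rightarrow> 'v::linorder set set) \<Rightarrow> (real \<times> ereal) list" where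
  "barcode k X = (SOME bs. is_barcode k X bs)"

definition lifetime_sum :: "int \<Rightarrow> (real \<Rightarrow> 'v::linorder set set) \<Rightarrow> ennreal" where
  "lifetime_sum k X = (\<Sum>(b, d)\<leftarrow>barcode k X. e2ennreal (d - ereal b))"

definition truncated_lifetime_sum ::
  "int \<Rightarrow> (real \<Rightarrow> 'v::linorder set set) \<Rightarrow> real \<Rightarrow> real" where
  "truncated_lifetime_sum k X T =
     (\<Sum>(b, d)\<leftarrow>barcode k X. real_of_ereal (min d (ereal T)) - min b T)"


subsection \<open>The multi-parameter random complex process\<close>

definition nonempty_subsets :: "'v set \<Rightarrow> 'v set set" where
  "nonempty_subsets V = Pow V - {{}}"

definition complex_filtration ::
  "'v set \<Rightarrow> ('v set \<Rightarrow> 'a \<Rightarrow> real) \<Rightarrow> 'a \<Rightarrow> real \<Rightarrow> 'v set set" where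
  "complex_filtration V u \<omega> t =
     {\<sigma> \<in> nonempty_subsets V. \<forall>\<tau>. \<tau> \<noteq> {} \<and> \<tau> \<subseteq> \<sigma> \<longrightarrow> u \<tau> \<omega> \<le> t}"

text \<open>
  The condition on \<open>cdf\<close> says that \<open>u \<sigma>\<close> has the distribution function \<open>p i\<close>, where \<open>i\<close> is the
  dimension of \<open>\<sigma>\<close>.
\<close>

definition multiparameter_process ::
  "(nat \<Rightarrow> real \<Rightarrow> real) \<Rightarrow> 'v set \<Rightarrow> 'a measure \<Rightarrow> ('v set \<Rightarrow> 'a \<Rightarrow> real) \<Rightarrow> bool" where
  "multiparameter_process p V M u \<longleftrightarrow>
     prob_space M \<and> finite V \<and>
     prob_space.indep_vars M (\<lambda>_. borel) u (nonempty_subsets V) \<and>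
     (\<forall>\<sigma>\<in>nonempty_subsets V.
        (\<forall>\<omega>\<in>space M. 0 \<le> u \<sigma> \<omega>) \<and>
        (\<forall>t. cdf (distr M borel (u \<sigma>)) t = p (card \<sigma> - 1) t))"


subsection \<open>The associated functions\<close>

text \<open>
  The index \<open>k\<close> ranges over the integers \<open>k \<ge> -1\<close>. In \<open>qfun\<close>, the index set \<open>{0..k}\<close> of the
  product is empty for \<open>k = -1\<close>.
\<close>

definition qfun :: "(nat \<Rightarrow> real \<Rightarrow> real) \<Rightarrow> int \<Rightarrow> real \<Rightarrow> real" where
  "qfun p k t = (\<Prod>i<nat (k + 1). p i t ^ (nat (k + 1) choose (i + 1)))"

definition rfun :: "(nat \<Rightarrow> real \<Rightarrow> real) \<Rightarrow> int \<Rightarrow> real \<Rightarrow> real" where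
  "rfun p k t = (\<Prod>i\<le>nat (k + 1). p i t ^ (nat (k + 1) choose i))"

definition rcheck :: "(nat \<Rightarrow> real \<Rightarrow> real) \<Rightarrow> int \<Rightarrow> real \<Rightarrow> real" where
  "rcheck p k u = Inf {t. 0 \<le> t \<and> u < rfun p k t}"

definition Qfun :: "(nat \<Rightarrow> real \<Rightarrow> real) \<Rightarrow> int \<Rightarrow> real \<Rightarrow> real" where
  "Qfun p k t = (LINT s:{0..t}|lborel. qfun p k s)"

definition Phi :: "(nat \<Rightarrow> real \<Rightarrow> real) \<Rightarrow> int \<Rightarrow> real \<Rightarrow> real" where
  "Phi p k u = Qfun p k (rcheck p k u)"

definition Psi :: "(nat \<Rightarrow> real \<Rightarrow> real) \<Rightarrow> int \<Rightarrow> real \<Rightarrow> real" where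
  "Psi p k u = Qfun p k (rcheck p (k - 1) u)"

end

theory Submission
  imports Defs
begin

text \<open>
  By the Morse inequalities \<open>\<beta>\<^sub>k \<ge> f\<^sub>k - f\<^sub>k\<^sub>+\<^sub>1 - f\<^sub>k\<^sub>-\<^sub>1\<close> and \<open>q\<^sub>k\<^sub>+\<^sub>1 = q\<^sub>k r\<^sub>k\<close>, the expected Betti number
  at a time with \<open>r\<^sub>k\<^sub>-\<^sub>1 > a / n\<close> and \<open>r\<^sub>k \<le> b / n\<close> is at least
  \<open>(n choose (k + 1)) q\<^sub>k (1 - b / (k + 2) - (k + 1) / a - o(1))\<close>. These times form the interval between
  \<open>rcheck (k - 1) (a / n)\<close> and \<open>rcheck k (b / n)\<close>, on which \<open>q\<^sub>k\<close> has integral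
  \<open>Phi (b / n) - Psi (a / n) \<ge> (1 - 1 / B) Phi (b / n)\<close> when \<open>b = D a\<close>. For \<open>b = (k + 2) / 2\<close> the
  constant is positive exactly if \<open>D < (k + 2) / (4 (k + 1))\<close>, and \<open>b \<ge> 1\<close> gives
  \<open>Phi (b / n) \<ge> Phi (1 / n)\<close>.

  Lifetime sums are integrals of Betti numbers once a barcode exists. The cycles and the boundaries
  of the filtration form two chains of subspaces of one finite-dimensional space; a basis adapted to
  both chains splits the persistent homology into intervals, a basis vector living from the time it
  becomes a cycle until the time it becomes a boundary.
\<close>

subsection \<open>Finite-dimensional subspaces\<close>

text \<open>\<open>barcode\<close> picks an arbitrary barcode, so nothing can be said about lifetime
  sums until one is known to exist. The ring of combinations of \<open>z^t\<close> with real
  exponents is not a principal ideal domain, so the usual classification of finitely generated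
  modules does not apply directly. Linear algebra suffices because all induced maps come from the
  identity on chains: the whole module is encoded in two increasing families of subspaces, and two
  chains of subspaces always admit a common adapted basis, whereas three general subspaces need not.

  The space of all formal chains may be infinite-dimensional, and \<open>dim\<close> is 0 for an
  infinite basis; finiteness is therefore carried along as containment in \<open>span F\<close> for
  a finite \<open>F\<close>.

  The value \<open>b = (k + 2) / 2\<close> comes from minimising the loss
  \<open>b / (k + 2) + D * (k + 1) / b\<close> over \<open>b\<close>. The minimum is
  \<open>2 * sqrt (D * (k + 1) / (k + 2))\<close>, which is below 1 exactly in the assumed range of
  \<open>D\<close>, and at the upper end of that range the minimiser is \<open>(k + 2) / 2\<close>.
  So this single \<open>b\<close> serves every admissible \<open>D\<close>.\<close>

lemma subspace_basis_exists:
  fixes V :: "'a::real_vector set"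
  assumes "subspace V" "V \<subseteq> span F" "finite F"
  obtains B where "independent B" "finite B" "span B = V" "card B = dim V"
proof -
  obtain B where B: "B \<subseteq> V" "independent B" "V \<subseteq> span B" "card B = dim V"
    using basis_exists by metis
  have "span B = V"
    using B span_minimal[OF B(1) assms(1)] by blast
  moreover have "finite B"
    using real_vector.independent_span_bound[of F B] B assms by blast
  ultimately show thesis using B that by blast
qed

lemma dim_mono_span:
  fixes V :: "'a::real_vector set"
  assumes "U \<subseteq> V" "V \<subseteq> span F" "finite F"
  shows "dim U \<le> dim V"
proof -
  obtain B where B: "independent B" "finite B" "span B = span V" "card B = dim (span V)"
    using subspace_basis_exists[of "span V" F] assms
    by (metis real_vector.subspace_span real_vector.span_minimal)
  have "U \<subseteq> span B" using assms(1) B(3) span_superset by blast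
  then have "dim U \<le> card B" using B(2) by (rule real_vector.dim_le_card)
  then show ?thesis using B(4) by simp
qed

lemma subspace_dim_equal_span:
  fixes V :: "'a::real_vector set"
  assumes "U \<subseteq> V" "V \<subseteq> span F" "finite F" "subspace U" "dim V \<le> dim U"
  shows "U = V"
proof (rule ccontr)
  assume "U \<noteq> V"
  then obtain v where v: "v \<in> V" "v \<notin> U" using assms(1) by blast
  obtain B where B: "independent B" "finite B" "span B = U" "card B = dim U"
    using subspace_basis_exists[of U F] assms by blast
  have "independent (insert v B)" "v \<notin> B"
    using v B span_superset[of B] by (auto simp: real_vector.independent_insert)
  then have "dim (insert v B) = Suc (dim U)"
    using B real_vector.dim_eq_card_independent[of "insert v B"] by simp
  moreover have "dim (insert v B) \<le> dim V"
    using v B span_superset[of B] assms by (intro dim_mono_span[of _ _ F]) auto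
  ultimately show False using assms(5) by simp
qed

text \<open>Linearity is asked for on \<open>S\<close> only, because one application takes a graded
  isomorphism, whose values outside the homology are unconstrained.\<close>

lemma rank_nullity_subspace:
  fixes f :: "'a::real_vector \<Rightarrow> 'b::real_vector"
  assumes S: "subspace S" "S \<subseteq> span F" "finite F"
    and add: "\<And>x y. x \<in> S \<Longrightarrow> y \<in> S \<Longrightarrow> f (x + y) = f x + f y"
    and scale: "\<And>a x. x \<in> S \<Longrightarrow> f (a *\<^sub>R x) = a *\<^sub>R f x"
  shows "dim S = dim (f ` S) + dim {x \<in> S. f x = 0}"
proof -
  define N where "N = {x \<in> S. f x = 0}"
  have f0: "f 0 = 0" using scale[of 0 0] S(1) by (simp add: subspace_0)
  have N: "subspace N"
    unfolding N_def using S(1) f0 add scale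
    by (auto simp: subspace_def)
  have "N \<subseteq> S" by (auto simp: N_def)
  obtain B0 where B0: "independent B0" "finite B0" "span B0 = N" "card B0 = dim N"
    using subspace_basis_exists[OF N order_trans[OF \<open>N \<subseteq> S\<close> S(2)] S(3)] by blast
  have "B0 \<subseteq> S" using B0 \<open>N \<subseteq> S\<close> span_superset by blast
  obtain B where B: "B0 \<subseteq> B" "B \<subseteq> S" "independent B" "S \<subseteq> span B"
    using real_vector.maximal_independent_subset_extend[OF \<open>B0 \<subseteq> S\<close> B0(1)] by metis
  have finB: "finite B"
    using real_vector.independent_span_bound[of F B] B S by blast
  have spB: "span B = S" using B(2,4) S(1) span_minimal by blast
  \<comment> \<open>\<open>f\<close> may be arbitrary off \<open>S\<close>; \<open>g\<close> is a
    genuine linear map with the same values on the basis, and it agrees with \<open>f\<close> on all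
    of \<open>S\<close>.\<close>
  define g where "g = real_vector.construct B f"
  have g: "linear g" unfolding g_def by (rule real_vector.linear_construct[OF B(3)])
  have gB: "g b = f b" if "b \<in> B" for b
    unfolding g_def by (rule real_vector.construct_basis[OF B(3) that])
  have gf: "g x = f x" if "x \<in> S" for x
  proof -
    have "x \<in> span B" using that spB by simp
    then have "x \<in> S \<and> g x = f x"
    proof (induction rule: span_induct_alt)
      case base then show ?case using f0 S(1) g by (simp add: linear_0 subspace_0)
    next
      case (step c x y)
      then have "x \<in> S" using B by blast
      with step show ?case using S(1) add scale gB g
        by (simp add: linear_add linear_scale subspace_add subspace_scale)
    qed
    then show ?thesis by simp
  qed
  have im: "f ` S = span (f ` (B - B0))"
  proof -
    have "f ` S = g ` span B" using gf spB by auto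
    also have "\<dots> = span (g ` B)" using g by (simp add: linear_span_image)
    also have "\<dots> = span (g ` (B - B0))"
    proof -
      have "g b = 0" if "b \<in> B0" for b
        using that B0(3) span_superset gB B(1) unfolding N_def by (metis (mono_tags, lifting) mem_Collect_eq subset_iff)
      then have "g ` B \<subseteq> insert 0 (g ` (B - B0))" by auto
      then have "span (g ` B) \<subseteq> span (g ` (B - B0))"
        by (metis real_vector.span_insert_0 span_mono)
      moreover have "span (g ` (B - B0)) \<subseteq> span (g ` B)" by (intro span_mono) auto
      ultimately show ?thesis by blast
    qed
    also have "g ` (B - B0) = f ` (B - B0)" using gB by auto
    finally show ?thesis .
  qed
  have inj: "inj_on g (span (B - B0))"
  proof (subst linear_inj_on_iff_eq_0[OF g])
    show "subspace (span (B - B0))" by simp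
    show "\<forall>x\<in>span (B - B0). g x = 0 \<longrightarrow> x = 0"
    proof (intro ballI impI)
      fix x assume x: "x \<in> span (B - B0)" "g x = 0"
      then have "x \<in> S" using spB span_mono[of "B - B0" B] by blast
      then have "x \<in> span B0" using x gf B0 by (simp add: N_def)
      \<comment> \<open>A vector in both \<open>span B0\<close> and \<open>span (B - B0)\<close> has
        its coordinates supported in two disjoint sets, so all of them vanish.\<close>
      have "real_vector.representation B x = real_vector.representation (B - B0) x"
        using B(3) x(1) by (intro real_vector.representation_extend) auto
      moreover have "real_vector.representation B x = real_vector.representation B0 x"
        using B \<open>x \<in> span B0\<close> by (intro real_vector.representation_extend) auto
      ultimately have "real_vector.representation B x b = 0" for b
        by (metis Diff_iff real_vector.representation_ne_zero)
      then show "x = 0"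
        using real_vector.sum_nonzero_representation_eq[OF B(3), of x] \<open>x \<in> S\<close> spB by simp
    qed
  qed
  have "independent (g ` (B - B0))"
    using real_vector.linear_independent_injective_image[OF g] inj B(3)
      independent_mono[OF B(3), of "B - B0"]
    by (metis Diff_subset real_vector.linear_inj_on_span_iff_independent_image g inj)
  then have "dim (f ` S) = card (g ` (B - B0))"
    using im gB real_vector.dim_span_eq_card_independent
    by (metis (no_types, lifting) DiffD1 image_cong)
  also have "\<dots> = card (B - B0)"
    using inj by (meson card_image inj_on_subset span_superset)
  also have "\<dots> = card B - card B0" using B(1) B0(2) by (simp add: card_Diff_subset)
  finally have "dim (f ` S) = card B - card B0" .
  moreover have "card B0 \<le> card B" using B(1) finB card_mono by blast
  moreover have "dim S = card B" using spB B(3) real_vector.dim_span_eq_card_independent by blast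
  ultimately show ?thesis using B0(4) unfolding N_def by simp
qed

text \<open>Extend a basis of \<open>S\<close> to one of \<open>V\<close> and drop one of the added
  vectors.\<close>

lemma hyperplane_exists:
  fixes V :: "'a::real_vector set"
  assumes "subspace S" "subspace V" "S \<subset> V" "V \<subseteq> span F" "finite F"
  obtains H v where "subspace H" "S \<subseteq> H" "H \<subseteq> V" "v \<in> V" "v \<notin> H" "V = span (insert v H)"
proof -
  obtain B0 where B0: "independent B0" "finite B0" "span B0 = S"
    using subspace_basis_exists[of S F] assms by blast
  have "B0 \<subseteq> V" using B0 assms(3) span_superset by blast
  obtain B where B: "B0 \<subseteq> B" "B \<subseteq> V" "independent B" "V \<subseteq> span B"
    using real_vector.maximal_independent_subset_extend[OF \<open>B0 \<subseteq> V\<close> B0(1)] by metis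
  have spB: "span B = V" using B(2,4) assms(2) span_minimal by blast
  obtain v where v: "v \<in> B" "v \<notin> B0" using B0(3) spB assms(3) span_mono[of B B0] by blast
  show thesis
  proof
    show "subspace (span (B - {v}))" by simp
    show "S \<subseteq> span (B - {v})" using B0(3) v B(1) span_mono[of B0 "B - {v}"] by blast
    show "span (B - {v}) \<subseteq> V" using spB span_mono[of "B - {v}" B] by blast
    show "v \<in> V" using v B by blast
    show "v \<notin> span (B - {v})" using v B(3) by (auto simp: real_vector.dependent_def)
    have "span (insert v (span (B - {v}))) = span (insert v (B - {v}))"
      by (simp only: real_vector.span_insert real_vector.span_span)
    then show "V = span (insert v (span (B - {v})))" using v spB by (simp add: insert_absorb)
  qed
qed

text \<open>
  The induction removes a hyperplane \<open>H\<close> containing all proper members of the first chain. The basis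
  of \<open>H\<close> is completed by a vector of the smallest member of the second chain that is not inside \<open>H\<close>.
\<close>

lemma adapted_basis_exists:
  fixes V :: "'a::real_vector set"
  assumes "subspace V" "V \<subseteq> span F" "finite F"
    and "\<forall>S\<in>\<A> \<union> \<B>. subspace S \<and> S \<subseteq> V"
    and "\<forall>S\<in>\<A>. \<forall>T\<in>\<A>. S \<subseteq> T \<or> T \<subseteq> S" "\<forall>S\<in>\<B>. \<forall>T\<in>\<B>. S \<subseteq> T \<or> T \<subseteq> S"
  shows "\<exists>E. finite E \<and> independent E \<and> span E = V \<and> (\<forall>S\<in>\<A> \<union> \<B>. span (E \<inter> S) = S)"
  using assms
proof (induction "dim V" arbitrary: V \<A> \<B> rule: less_induct)
  case less
  note V = less.prems(1,2,3) and sub = less.prems(4) and chA = less.prems(5) and chB = less.prems(6)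
  show ?case
  proof (cases "V = {0}")
    case True
    then have "S = {0}" if "S \<in> \<A> \<union> \<B>" for S
      using sub that subspace_0 by blast
    then show ?thesis using True by (intro exI[of _ "{}"]) (auto simp: real_vector.independent_empty)
  next
    case False
    \<comment> \<open>Including \<open>{0}\<close> guarantees a largest proper member also when
      \<open>\<A>\<close> is empty or contains only \<open>V\<close>.\<close>
    define P where "P = insert {0} {S\<in>\<A>. S \<noteq> V}"
    have P: "subspace S \<and> S \<subset> V" if "S \<in> P" for S
      using that False sub V(1) subspace_0[OF V(1)] by (auto simp: P_def)
    have dim_lt: "dim S < Suc (dim V)" if "S \<in> P" for S
      using P[OF that] dim_mono_span[OF _ V(2,3), of S] by (simp add: less_Suc_eq_le psubset_imp_subset)
    \<comment> \<open>The chains may be infinite; a largest member still exists because the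
      dimensions are bounded.\<close>
    have "\<exists>S. S \<in> P \<and> (\<forall>T. T \<in> P \<longrightarrow> dim T \<le> dim S)"
      by (rule ex_has_greatest_nat[of _ "{0}" dim "Suc (dim V)"])
        (use dim_lt in \<open>auto simp: P_def\<close>)
    then obtain S where S: "S \<in> P" "\<And>T. T \<in> P \<Longrightarrow> dim T \<le> dim S" by blast
    have chP: "T \<subseteq> S \<or> S \<subseteq> T" if "T \<in> P" for T
      using that S(1) chA P subspace_0 unfolding P_def by blast
    have PS: "T \<subseteq> S" if "T \<in> P" for T
      using chP[OF that] P[OF that] P[OF S(1)] S(2)[OF that] V subspace_dim_equal_span[of S T F]
      by (metis order_refl psubset_imp_subset subset_trans)
    obtain H v where H: "subspace H" "S \<subseteq> H" "H \<subseteq> V" "v \<in> V" "v \<notin> H" "V = span (insert v H)"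
      using hyperplane_exists[of S V F] P[OF S(1)] V by metis
    have "dim H < dim V"
      using subspace_dim_equal_span[of H V F] H V dim_mono_span[of H V F] by (metis leI)
    define \<B>' where "\<B>' = (\<lambda>T. T \<inter> H) ` \<B>"
    have "\<exists>E. finite E \<and> independent E \<and> span E = H \<and> (\<forall>S\<in>(\<A> - {V}) \<union> \<B>'. span (E \<inter> S) = S)"
    proof (rule less.hyps[OF \<open>dim H < dim V\<close>])
      show "H \<subseteq> span F" using H V by blast
      show "\<forall>S\<in>\<A> - {V} \<union> \<B>'. subspace S \<and> S \<subseteq> H"
        using PS H sub by (auto simp: \<B>'_def P_def subspace_inter)
      show "\<forall>S\<in>\<B>'. \<forall>T\<in>\<B>'. S \<subseteq> T \<or> T \<subseteq> S"
        using chB unfolding \<B>'_def by blast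
    qed (use H V chA in auto)
    then obtain E where E: "finite E" "independent E" "span E = H"
      and EA: "\<And>T. T \<in> \<A> - {V} \<Longrightarrow> span (E \<inter> T) = T"
      and "\<And>T. T \<in> \<B>' \<Longrightarrow> span (E \<inter> T) = T"
      by (metis UnI1 UnI2)
    then have EB: "\<And>T. T \<in> \<B> \<Longrightarrow> span (E \<inter> (T \<inter> H)) = T \<inter> H"
      by (auto simp: \<B>'_def)
    \<comment> \<open>Adding \<open>V\<close> keeps \<open>C\<close> nonempty when all of
      \<open>\<B>\<close> lies in \<open>H\<close>, and makes the spanning of \<open>V\<close> an
      instance of \<open>main\<close>.\<close>
    define C where "C = {T \<in> insert V \<B>. \<not> T \<subseteq> H}"
    have chC: "T \<subseteq> T' \<or> T' \<subseteq> T" if "T \<in> C" "T' \<in> C" for T T'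
      using that chB sub unfolding C_def by blast
    have subC: "subspace T \<and> T \<subseteq> V" if "T \<in> C" for T
      using that sub V unfolding C_def by blast
    have "V \<in> C" using H by (auto simp: C_def)
    then obtain T where T: "T \<in> C" "\<And>T'. T' \<in> C \<Longrightarrow> dim T \<le> dim T'"
      using ex_has_least_nat[of "\<lambda>T. T \<in> C" V dim] by blast
    have Tmin: "T \<subseteq> T'" if "T' \<in> C" for T'
      using chC[OF that T(1)] T(2)[OF that] subspace_dim_equal_span[of T' T F] subC[OF that] subC[OF T(1)] V
      by (metis order_refl subset_trans)
    obtain w where w: "w \<in> T" "w \<notin> H" using T(1) by (auto simp: C_def)
    have decomp: "\<exists>a h. h \<in> H \<and> x = a *\<^sub>R w + h" if "x \<in> V" for x
    proof -
      have *: "\<exists>a h. h \<in> H \<and> y = a *\<^sub>R v + h" if "y \<in> V" for y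
      proof -
        have "y \<in> span (insert v H)" using that H(6) by simp
        then obtain a where "y - a *\<^sub>R v \<in> span H" by (auto simp: real_vector.span_insert)
        then have "y - a *\<^sub>R v \<in> H" using H(1) by (simp add: span_eq_iff[THEN iffD2])
        then show ?thesis by (intro exI[of _ a] exI[of _ "y - a *\<^sub>R v"]) simp
      qed
      have "w \<in> V" using w T(1) subC by blast
      then obtain b h where b: "h \<in> H" "w = b *\<^sub>R v + h" using * by blast
      have "b \<noteq> 0" using b w by auto
      obtain a g where a: "g \<in> H" "x = a *\<^sub>R v + g" using * \<open>x \<in> V\<close> by blast
      have "x = (a / b) *\<^sub>R w + (g - (a / b) *\<^sub>R h)"
        using a b \<open>b \<noteq> 0\<close> by (simp add: algebra_simps)
      moreover have "g - (a / b) *\<^sub>R h \<in> H" using a b H(1) by (simp add: subspace_diff subspace_scale)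
      ultimately show ?thesis by blast
    qed
    have wE: "w \<notin> E" using w E(3) span_superset by blast
    \<comment> \<open>By minimality of \<open>T\<close>, every member of \<open>C\<close> contains
      \<open>w\<close>. Subtracting the \<open>w\<close>-part of a vector of \<open>T'\<close>
      therefore stays in \<open>T'\<close> and lands in \<open>T' \<inter> H\<close>, which
      \<open>E\<close> already spans.\<close>
    have main: "span (insert w E \<inter> T') = T'" if "T' \<in> C" for T'
    proof
      show "span (insert w E \<inter> T') \<subseteq> T'"
        using subC[OF that] by (metis inf_le2 span_minimal)
      show "T' \<subseteq> span (insert w E \<inter> T')"
      proof
        fix x assume x: "x \<in> T'"
        have wT': "w \<in> T'" using w Tmin[OF that] by blast
        obtain a h where ah: "h \<in> H" "x = a *\<^sub>R w + h" using decomp x subC[OF \<open>T' \<in> C\<close>] by blast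
        then have "h = x - a *\<^sub>R w" by simp
        then have "h \<in> T' \<inter> H"
          using x wT' ah(1) subC[OF \<open>T' \<in> C\<close>] by (metis IntI subspace_diff subspace_scale)
        moreover have "span (E \<inter> (T' \<inter> H)) = T' \<inter> H"
        proof (cases "T' = V")
          case True
          then show ?thesis using H(3) E(3) span_superset[of E]
            by (metis inf.absorb_iff2 inf.orderE)
        next
          case False then show ?thesis using EB that by (auto simp: C_def)
        qed
        ultimately have "h \<in> span (E \<inter> (T' \<inter> H))" by simp
        then have "h \<in> span (insert w E \<inter> T')" 
          using span_mono[of "E \<inter> (T' \<inter> H)" "insert w E \<inter> T'"] by blast
        moreover have "w \<in> span (insert w E \<inter> T')" using wT' by (simp add: span_base)
        ultimately show "x \<in> span (insert w E \<inter> T')"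
          using ah by (simp add: span_add span_scale)
      qed
    qed
    show ?thesis
    proof (intro exI[of _ "insert w E"] conjI ballI)
      show "finite (insert w E)" using E by simp
      show "independent (insert w E)" using E w by (simp add: real_vector.independent_insertI)
      have "insert w E \<subseteq> V" using w E(3) H(3) span_superset[of E] subC[OF T(1)] by blast
      then show spV: "span (insert w E) = V" using main[OF \<open>V \<in> C\<close>] by (simp add: inf.absorb1)
      fix U assume U: "U \<in> \<A> \<union> \<B>"
      show "span (insert w E \<inter> U) = U"
      proof (cases "U \<subseteq> H")
        case True
        then have "insert w E \<inter> U = E \<inter> U" "w \<notin> U" using w by auto
        moreover have "span (E \<inter> U) = U"
        proof (cases "U \<in> \<B>")
          case True then show ?thesis using EB[OF True] \<open>U \<subseteq> H\<close> by (simp add: inf.absorb1)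
        next
          case False then show ?thesis using EA U \<open>U \<subseteq> H\<close> H by blast
        qed
        ultimately show ?thesis by simp
      next
        case False
        \<comment> \<open>Proper members of the first chain lie in \<open>S\<close>, hence in
          \<open>H\<close>.\<close>
        then have "U = V \<or> U \<in> \<B>" using U PS H(2) by (auto simp: P_def)
        then have "U \<in> C" using False by (auto simp: C_def)
        then show ?thesis by (rule main)
      qed
    qed
  qed
qed

section \<open>Formal real combinations with support in a finite set\<close>

lemma scaleR_poly_mapping_lookup [simp]:
  "Poly_Mapping.lookup (a *\<^sub>R x) i = a *\<^sub>R Poly_Mapping.lookup x i"
proof -
  have "finite {i. a *\<^sub>R Poly_Mapping.lookup x i \<noteq> 0}"
    by (rule finite_subset[OF _ finite_keys[of x]]) (auto simp: in_keys_iff)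
  then show ?thesis by (simp add: scaleR_poly_mapping_def)
qed

lemma poly_mapping_sum_single:
  fixes c :: "'i \<Rightarrow>\<^sub>0 real"
  assumes "finite A" "Poly_Mapping.keys c \<subseteq> A"
  shows "c = (\<Sum>i\<in>A. Poly_Mapping.lookup c i *\<^sub>R Poly_Mapping.single i 1)"
proof (rule poly_mapping_eqI)
  fix j
  have "Poly_Mapping.lookup (\<Sum>i\<in>A. Poly_Mapping.lookup c i *\<^sub>R Poly_Mapping.single i (1::real)) j
    = (\<Sum>i\<in>A. if i = j then Poly_Mapping.lookup c j else 0)"
    by (auto simp: lookup_sum lookup_single when_def intro!: sum.cong)
  also have "\<dots> = Poly_Mapping.lookup c j"
    using assms by (auto simp: in_keys_iff)
  finally show "Poly_Mapping.lookup c j = Poly_Mapping.lookup (\<Sum>i\<in>A. Poly_Mapping.lookup c i *\<^sub>R Poly_Mapping.single i 1) j"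
    by simp
qed

lemma subspace_keys: "subspace {c :: 'i \<Rightarrow>\<^sub>0 real. Poly_Mapping.keys c \<subseteq> A}"
  by (auto simp: subspace_def in_keys_iff lookup_add subset_iff) (metis add.right_neutral)

lemma span_single:
  assumes "finite A"
  shows "span ((\<lambda>i. Poly_Mapping.single i (1::real)) ` A) = {c. Poly_Mapping.keys c \<subseteq> A}"
proof
  show "span ((\<lambda>i. Poly_Mapping.single i (1::real)) ` A) \<subseteq> {c. Poly_Mapping.keys c \<subseteq> A}"
    by (rule span_minimal) (auto simp: subspace_keys split: if_splits)
  show "{c. Poly_Mapping.keys c \<subseteq> A} \<subseteq> span ((\<lambda>i. Poly_Mapping.single i (1::real)) ` A)"
  proof
    fix c :: "'a \<Rightarrow>\<^sub>0 real" assume "c \<in> {c. Poly_Mapping.keys c \<subseteq> A}"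
    then have "c = (\<Sum>i\<in>A. Poly_Mapping.lookup c i *\<^sub>R Poly_Mapping.single i 1)"
      using poly_mapping_sum_single assms by blast
    moreover have "\<dots> \<in> span ((\<lambda>i. Poly_Mapping.single i (1::real)) ` A)"
      by (intro span_sum span_scale span_base) auto
    ultimately show "c \<in> span ((\<lambda>i. Poly_Mapping.single i (1::real)) ` A)" by simp
  qed
qed

lemma independent_single:
  "finite A \<Longrightarrow> independent ((\<lambda>i. Poly_Mapping.single i (1::real)) ` A)"
proof (induction A rule: finite_induct)
  case (insert a A)
  have "Poly_Mapping.single a (1::real) \<notin> span ((\<lambda>i. Poly_Mapping.single i 1) ` A)"
    using insert.hyps by (simp add: span_single)
  then show ?case using insert.IH by (simp add: real_vector.independent_insertI)
qed (simp add: real_vector.independent_empty)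

lemma dim_keys:
  assumes "finite A"
  shows "dim {c :: 'i \<Rightarrow>\<^sub>0 real. Poly_Mapping.keys c \<subseteq> A} = card A"
proof -
  have "dim {c :: 'i \<Rightarrow>\<^sub>0 real. Poly_Mapping.keys c \<subseteq> A} = card ((\<lambda>i. Poly_Mapping.single i (1::real)) ` A)"
    by (rule real_vector.dim_eq_card) (use assms in \<open>simp_all add: span_single[symmetric] independent_single real_vector.span_span\<close>)
  also have "\<dots> = card A"
  proof (rule card_image)
    show "inj_on (\<lambda>i. Poly_Mapping.single i (1::real)) A"
    proof (rule inj_onI)
      fix i j :: 'i assume "Poly_Mapping.single i (1::real) = Poly_Mapping.single j 1"
      then have "Poly_Mapping.keys (Poly_Mapping.single i (1::real)) = Poly_Mapping.keys (Poly_Mapping.single j (1::real))" by simp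
      then show "i = j" by simp
    qed
  qed
  finally show ?thesis .
qed

subsection \<open>The chain complex\<close>

definition simplex_boundary :: "'v::linorder set \<Rightarrow> ('v set \<Rightarrow>\<^sub>0 real)" where
  "simplex_boundary \<sigma> = (\<Sum>v\<in>\<sigma>. Poly_Mapping.single (\<sigma> - {v}) ((-1) ^ card {w \<in> \<sigma>. w < v}))"

lemma single_scaleR: "Poly_Mapping.single i (a * b) = a *\<^sub>R Poly_Mapping.single i (b::real)"
  by (rule poly_mapping_eqI) (simp add: lookup_single when_def)

text \<open>In the definition of \<open>boundary\<close> the index set depends on the chain. Summing
  over a common superset of the supports makes linearity a property of finite sums.\<close>

lemma boundary_eq_sum:
  assumes "finite A" "Poly_Mapping.keys c \<subseteq> A"
  shows "boundary c = (\<Sum>\<sigma>\<in>A. Poly_Mapping.lookup c \<sigma> *\<^sub>R simplex_boundary \<sigma>)"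
proof -
  have "boundary c = (\<Sum>\<sigma>\<in>Poly_Mapping.keys c. Poly_Mapping.lookup c \<sigma> *\<^sub>R simplex_boundary \<sigma>)"
    unfolding boundary_def simplex_boundary_def scaleR_sum_right
    by (intro sum.cong refl) (simp add: mult.commute single_scaleR[symmetric])
  also have "\<dots> = (\<Sum>\<sigma>\<in>A. Poly_Mapping.lookup c \<sigma> *\<^sub>R simplex_boundary \<sigma>)"
    by (rule sum.mono_neutral_left) (use assms in \<open>auto simp: in_keys_iff\<close>)
  finally show ?thesis .
qed

lemma linear_boundary: "linear (boundary :: ('v::linorder set \<Rightarrow>\<^sub>0 real) \<Rightarrow> _)"
proof (rule linearI)
  fix x y :: "'v set \<Rightarrow>\<^sub>0 real" and a :: real
  define A where "A = Poly_Mapping.keys x \<union> Poly_Mapping.keys y"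
  have "finite A" "Poly_Mapping.keys x \<subseteq> A" "Poly_Mapping.keys y \<subseteq> A" "Poly_Mapping.keys (x + y) \<subseteq> A"
    using keys_add[of x y] by (auto simp: A_def)
  then show "boundary (x + y) = boundary x + boundary y"
    by (simp add: boundary_eq_sum[of A] lookup_add scaleR_left_distrib sum.distrib)
  have "Poly_Mapping.keys (a *\<^sub>R x) \<subseteq> Poly_Mapping.keys x" by (auto simp: in_keys_iff)
  then show "boundary (a *\<^sub>R x) = a *\<^sub>R boundary x"
    by (simp add: boundary_eq_sum[of "Poly_Mapping.keys x"] scaleR_sum_right)
qed

lemma boundary_single: "boundary (Poly_Mapping.single \<sigma> a) = a *\<^sub>R simplex_boundary \<sigma>"
  by (subst boundary_eq_sum[of "{\<sigma>}"]) auto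

lemma boundary_simplex_boundary: "boundary (simplex_boundary (\<sigma> :: 'v::linorder set)) = 0"
proof (cases "finite \<sigma>")
  case True
  define s where "s = (\<lambda>v. (-1::real) ^ card {w \<in> \<sigma>. w < v})"
  define s' where "s' = (\<lambda>v x. (-1::real) ^ card {w \<in> \<sigma> - {v}. w < x})"
  \<comment> \<open>\<open>g\<close> is antisymmetric, so the double sum defining the second boundary vanishes.\<close>
  define g where "g = (\<lambda>v x. if x = v then 0 else Poly_Mapping.single (\<sigma> - {v, x}) (s v * s' v x))"
  \<comment> \<open>Removing the smaller vertex \<open>x\<close> lowers the position of
    \<open>v\<close> by one, while removing \<open>v\<close> leaves the position of \<open>x\<close>
    unchanged; hence the opposite signs.\<close>
  have s_less: "s v * s' v x = - (s x * s' x v)" if "v \<in> \<sigma>" "x \<in> \<sigma>" "x < v" for v x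
  proof -
    have "{w \<in> \<sigma> - {v}. w < x} = {w \<in> \<sigma>. w < x}" using that by auto
    moreover have "{w \<in> \<sigma>. w < v} = insert x {w \<in> \<sigma> - {x}. w < v}" using that by auto
    then have "card {w \<in> \<sigma>. w < v} = Suc (card {w \<in> \<sigma> - {x}. w < v})" using True by simp
    ultimately show ?thesis by (simp add: s_def s'_def)
  qed
  have "g v x = - g x v" if "v \<in> \<sigma>" "x \<in> \<sigma>" for v x
  proof -
    consider "x = v" | "x < v" | "v < x" by fastforce
    then show ?thesis
    proof cases
      case 2
      then show ?thesis using s_less[of v x] that
        by (simp add: g_def insert_commute single_uminus[symmetric])
    next
      case 3
      then show ?thesis using s_less[of x v] that
        by (simp add: g_def insert_commute single_uminus[symmetric])
    qed (simp add: g_def)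
  qed
  then have "(\<Sum>v\<in>\<sigma>. \<Sum>x\<in>\<sigma>. g v x) = (\<Sum>v\<in>\<sigma>. \<Sum>x\<in>\<sigma>. - g x v)"
    by (intro sum.cong[OF refl])
  also have "\<dots> = - (\<Sum>v\<in>\<sigma>. \<Sum>x\<in>\<sigma>. g v x)"
    by (subst sum.swap) (simp add: sum_negf)
  finally have "(2::real) *\<^sub>R (\<Sum>v\<in>\<sigma>. \<Sum>x\<in>\<sigma>. g v x) = 0"
    by (simp only: scaleR_2 eq_neg_iff_add_eq_0)
  then have sum0: "(\<Sum>v\<in>\<sigma>. \<Sum>x\<in>\<sigma>. g v x) = 0" by simp
  have "boundary (simplex_boundary \<sigma>) = (\<Sum>v\<in>\<sigma>. s v *\<^sub>R simplex_boundary (\<sigma> - {v}))"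
    unfolding simplex_boundary_def[of \<sigma>] by (simp add: linear_sum[OF linear_boundary] boundary_single s_def)
  also have "\<dots> = (\<Sum>v\<in>\<sigma>. \<Sum>x\<in>\<sigma>. g v x)"
  proof (rule sum.cong[OF refl])
    fix v assume "v \<in> \<sigma>"
    have "s v *\<^sub>R simplex_boundary (\<sigma> - {v}) = (\<Sum>x\<in>\<sigma> - {v}. g v x)"
      unfolding simplex_boundary_def scaleR_sum_right
      by (rule sum.cong) (auto simp: g_def s'_def single_scaleR Diff_insert2[symmetric] insert_commute simp del: mult_minus_left)
    also have "\<dots> = (\<Sum>x\<in>\<sigma>. g v x)"
      by (rule sum.mono_neutral_left) (use True in \<open>auto simp: g_def\<close>)
    finally show "s v *\<^sub>R simplex_boundary (\<sigma> - {v}) = (\<Sum>x\<in>\<sigma>. g v x)" .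
  qed
  finally show ?thesis using sum0 by simp
\<comment> \<open>For infinite \<open>\<sigma>\<close> the sum defining
  \<open>simplex_boundary\<close> is 0 by default.\<close>
qed (simp add: simplex_boundary_def linear_0[OF linear_boundary])

lemma boundary_boundary: "boundary (boundary c) = 0"
  by (simp add: boundary_eq_sum[of "Poly_Mapping.keys c" c] linear_sum[OF linear_boundary]
      linear_scale[OF linear_boundary] boundary_simplex_boundary)

section \<open>Finite complexes, their Betti numbers and the Morse inequality\<close>

definition finite_complex :: "'v set set \<Rightarrow> bool" where
  "finite_complex K \<longleftrightarrow> finite K \<and> (\<forall>\<sigma>\<in>K. finite \<sigma> \<and> (\<forall>\<tau>\<subseteq>\<sigma>. \<tau> \<noteq> {} \<longrightarrow> \<tau> \<in> K))"

lemma finite_simplices: "finite_complex K \<Longrightarrow> finite (simplices k K)"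
  by (auto simp: finite_complex_def simplices_def)

lemma subspace_chains: "subspace (chains k K)"
  by (simp add: chains_def subspace_keys)

lemma subspace_boundaries: "subspace (boundaries k K)"
  unfolding boundaries_def by (intro linear_subspace_image linear_boundary subspace_chains)

lemma subspace_cycles: "subspace (cycles k K)"
  using subspace_chains[of k K] unfolding cycles_def
  by (auto simp: subspace_def linear_0[OF linear_boundary] linear_add[OF linear_boundary]
      linear_scale[OF linear_boundary])

lemma chains_span:
  "finite_complex K \<Longrightarrow> chains k K \<subseteq> span ((\<lambda>\<sigma>. Poly_Mapping.single \<sigma> (1::real)) ` simplices k K)"
  by (simp add: chains_def span_single finite_simplices)

lemma dim_chains: "finite_complex K \<Longrightarrow> dim (chains k K) = card (simplices k K)"
  by (simp add: chains_def dim_keys finite_simplices)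

lemma cycles_subset_chains: "cycles k K \<subseteq> chains k K"
  by (auto simp: cycles_def)

lemma boundary_chains:
  assumes "finite_complex K" "c \<in> chains (k + 1) K"
  shows "boundary c \<in> chains k K"
proof -
  have "Poly_Mapping.single (\<sigma> - {v}) a \<in> chains k K" if "\<sigma> \<in> simplices (k + 1) K" "v \<in> \<sigma>" for \<sigma> v a
  proof -
    have \<sigma>: "\<sigma> \<in> K" "finite \<sigma>" "int (card \<sigma>) = k + 2"
      using that assms(1) by (auto simp: simplices_def finite_complex_def)
    then have "\<sigma> - {v} \<in> insert {} K" using assms(1) by (cases "\<sigma> - {v} = {}") (auto simp: finite_complex_def)
    moreover have "card \<sigma> = Suc (card (\<sigma> - {v}))"
      using \<sigma>(2) that(2) by (metis card.remove)
    ultimately show ?thesis using \<sigma>(3) by (auto simp: chains_def simplices_def)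
  qed
  then show ?thesis
    using assms(2) unfolding boundary_def chains_def[of "k + 1"]
    by (intro subspace_sum subspace_chains) blast
qed

lemma boundaries_subset_cycles: "finite_complex K \<Longrightarrow> boundaries k K \<subseteq> cycles k K"
  by (auto simp: boundaries_def cycles_def boundary_chains boundary_boundary)

lemma chains_mono: "K \<subseteq> L \<Longrightarrow> chains k K \<subseteq> chains k L"
  by (auto simp: chains_def simplices_def)

lemma cycles_mono: "K \<subseteq> L \<Longrightarrow> cycles k K \<subseteq> cycles k L"
  using chains_mono[of K L k] by (auto simp: cycles_def)

lemma boundaries_mono: "K \<subseteq> L \<Longrightarrow> boundaries k K \<subseteq> boundaries k L"
  unfolding boundaries_def by (intro image_mono chains_mono)

text \<open>\<open>homology\<close> is a set of cosets, not a subspace with a \<open>dim\<close>, so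
  its dimension is expressed as a difference; \<open>card_alive_eq_betti\<close> links this number
  to barcodes.\<close>

definition betti :: "int \<Rightarrow> 'v::linorder set set \<Rightarrow> real" where
  "betti k K = real (dim (cycles k K)) - real (dim (boundaries k K))"

lemma dim_cycles_rank:
  "finite_complex K \<Longrightarrow> card (simplices k K) = dim (boundary ` chains k K) + dim (cycles k K)"
  using rank_nullity_subspace[OF subspace_chains chains_span, of K k boundary]
  by (simp add: finite_simplices dim_chains cycles_def linear_add[OF linear_boundary]
      linear_scale[OF linear_boundary])

lemma betti_nonneg:
  assumes "finite_complex K"
  shows "0 \<le> betti k K"
  using dim_mono_span[OF boundaries_subset_cycles[OF assms]
      order_trans[OF cycles_subset_chains chains_span[OF assms]]] finite_simplices[OF assms]
  by (simp add: betti_def)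

lemma betti_le: "finite_complex K \<Longrightarrow> betti k K \<le> card (simplices k K)"
  using dim_cycles_rank[of K k] by (simp add: betti_def)

text \<open>By rank and nullity, the cycles miss at most as many dimensions of the
  \<open>k\<close>-chains as there are simplices one dimension below, and the boundaries have at
  most as many dimensions as there are simplices one dimension above.\<close>

lemma morse_inequality:
  assumes "finite_complex K"
  shows "real (card (simplices k K)) - card (simplices (k + 1) K) - card (simplices (k - 1) K) \<le> betti k K"
proof -
  have "dim (boundary ` chains k K) \<le> dim (chains (k - 1) K)"
    using chains_span[OF assms] finite_simplices[OF assms] boundary_chains[OF assms, of _ "k - 1"]
    by (intro dim_mono_span) auto
  moreover have "dim (boundaries k K) \<le> card (simplices (k + 1) K)"
    using dim_cycles_rank[OF assms, of "k + 1"] by (simp add: boundaries_def)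
  ultimately show ?thesis
    using dim_cycles_rank[OF assms, of k] dim_chains[OF assms, of "k - 1"] by (simp add: betti_def)
qed

section \<open>Arithmetic of cosets\<close>

lemma subspace_plus_absorb:
  fixes B :: "'a::real_vector set"
  assumes "subspace B" "subspace C" "B \<subseteq> C"
  shows "B + C = C"
proof
  show "B + C \<subseteq> C" using assms by (auto simp: set_plus_def subspace_add)
  show "C \<subseteq> B + C" using set_plus_intro[OF subspace_0[OF assms(1)], of _ C] by auto
qed

lemma coset_add:
  fixes B :: "'a::real_vector set"
  assumes "subspace B"
  shows "(x +o B) + (y +o B) = (x + y) +o B"
  by (simp only: set_plus_rearrange subspace_plus_absorb[OF assms assms order_refl])

lemma coset_absorb:
  fixes B :: "'a::real_vector set"
  assumes "subspace B" "subspace C" "B \<subseteq> C"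
  shows "(x +o B) + C = x +o C"
  by (simp only: set_plus_rearrange3 subspace_plus_absorb[OF assms])

lemma coset_scale:
  fixes B :: "'a::real_vector set"
  assumes "subspace B"
  shows "(\<lambda>z. a *\<^sub>R z) ` (x +o B) + B = (a *\<^sub>R x) +o B"
proof
  show "(\<lambda>z. a *\<^sub>R z) ` (x +o B) + B \<subseteq> (a *\<^sub>R x) +o B"
  proof
    fix y assume "y \<in> (\<lambda>z. a *\<^sub>R z) ` (x +o B) + B"
    then obtain b c where "b \<in> B" "c \<in> B" "y = a *\<^sub>R (x + b) + c"
      by (auto simp: set_plus_def elt_set_plus_def)
    then have "y = a *\<^sub>R x + (a *\<^sub>R b + c)" "a *\<^sub>R b + c \<in> B"
      using assms by (auto simp: scaleR_right_distrib subspace_add subspace_scale)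
    then show "y \<in> (a *\<^sub>R x) +o B" by (auto simp: elt_set_plus_def)
  qed
  show "(a *\<^sub>R x) +o B \<subseteq> (\<lambda>z. a *\<^sub>R z) ` (x +o B) + B"
  proof
    fix y assume "y \<in> (a *\<^sub>R x) +o B"
    then obtain b where "b \<in> B" "y = a *\<^sub>R x + b" by (auto simp: elt_set_plus_def)
    moreover have "x \<in> x +o B" using subspace_0[OF assms] by (force simp: elt_set_plus_def)
    ultimately show "y \<in> (\<lambda>z. a *\<^sub>R z) ` (x +o B) + B" by (auto simp: set_plus_def)
  qed
qed

lemma coset_eq_iff:
  fixes B :: "'a::real_vector set"
  assumes "subspace B"
  shows "x +o B = y +o B \<longleftrightarrow> x - y \<in> B"
proof
  assume "x +o B = y +o B"
  moreover have "x \<in> x +o B" using subspace_0[OF assms] by (force simp: elt_set_plus_def)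
  ultimately show "x - y \<in> B" by (auto simp: elt_set_plus_def)
next
  assume xy: "x - y \<in> B"
  have *: "u +o B \<subseteq> v +o B" if "u - v \<in> B" for u v
  proof
    fix z assume "z \<in> u +o B"
    then obtain b where "b \<in> B" "z = v + ((u - v) + b)" by (auto simp: elt_set_plus_def)
    moreover have "(u - v) + b \<in> B" using that calculation(1) assms by (rule_tac subspace_add)
    ultimately show "z \<in> v +o B" unfolding elt_set_plus_def by blast
  qed
  have "y - x \<in> B" using subspace_neg[OF assms xy] by simp
  then show "x +o B = y +o B" using * xy by blast
qed

section \<open>Bars alive at a time and Betti numbers\<close>

lemma graded_isomorphicE:
  assumes "graded_isomorphic M N" "0 \<le> t"
  obtains \<phi> where "bij_betw \<phi> (gcomp M t) (gcomp N t)"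
    and "\<And>x y. x \<in> gcomp M t \<Longrightarrow> y \<in> gcomp M t \<Longrightarrow> \<phi> (gadd M t x y) = gadd N t (\<phi> x) (\<phi> y)"
    and "\<And>a x. x \<in> gcomp M t \<Longrightarrow> \<phi> (gscale M t a x) = gscale N t a (\<phi> x)"
proof -
  obtain \<psi> where "\<forall>t\<ge>0. bij_betw (\<psi> t) (gcomp M t) (gcomp N t) \<and>
     (\<forall>x\<in>gcomp M t. \<forall>y\<in>gcomp M t. \<psi> t (gadd M t x y) = gadd N t (\<psi> t x) (\<psi> t y)) \<and>
     (\<forall>a. \<forall>x\<in>gcomp M t. \<psi> t (gscale M t a x) = gscale N t a (\<psi> t x))"
    using assms(1) unfolding graded_isomorphic_def by metis
  then show thesis using assms(2) by (intro that[of "\<psi> t"]) auto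
qed

text \<open>The isomorphism in degree \<open>t\<close>, composed with the passage to cosets, is a
  linear surjection from the cycles whose kernel is the space of boundaries; rank and nullity give
  the count. The result holds for every barcode, in particular for the one that
  \<open>barcode\<close> selects.\<close>

lemma card_alive_eq_betti:
  assumes K: "finite_complex (X t)" and bs: "is_barcode k X bs" and t: "0 \<le> t"
  shows "real (card (alive bs t)) = betti k (X t)"
proof -
  define B where "B = boundaries k (X t)"
  define Z where "Z = cycles k (X t)"
  let ?M = "persistent_homology k X" and ?N = "interval_sum bs"
  have iso: "graded_isomorphic ?M ?N" using bs by (simp add: is_barcode_def)
  obtain \<phi> where \<phi>': "bij_betw \<phi> (gcomp ?M t) (gcomp ?N t)"
    "\<And>x y. x \<in> gcomp ?M t \<Longrightarrow> y \<in> gcomp ?M t \<Longrightarrow> \<phi> (gadd ?M t x y) = gadd ?N t (\<phi> x) (\<phi> y)"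
    "\<And>a x. x \<in> gcomp ?M t \<Longrightarrow> \<phi> (gscale ?M t a x) = gscale ?N t a (\<phi> x)"
    using graded_isomorphicE[OF iso t] by blast
  then have \<phi>: "bij_betw \<phi> (homology k (X t)) {c. Poly_Mapping.keys c \<subseteq> alive bs t}"
    "\<And>x y. x \<in> homology k (X t) \<Longrightarrow> y \<in> homology k (X t) \<Longrightarrow> \<phi> (x + y) = \<phi> x + \<phi> y"
    "\<And>a x. x \<in> homology k (X t) \<Longrightarrow> \<phi> ((\<lambda>z. a *\<^sub>R z) ` x + B) = a *\<^sub>R \<phi> x"
    by (simp_all add: persistent_homology_def interval_sum_def B_def)
  have sB: "subspace B" and sZ: "subspace Z" and BZ: "B \<subseteq> Z"
    using K by (auto simp: B_def Z_def subspace_boundaries subspace_cycles boundaries_subset_cycles[THEN subsetD])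
  have hom: "homology k (X t) = (\<lambda>z. z +o B) ` Z" by (simp add: homology_def B_def Z_def)
  define f where "f z = \<phi> (z +o B)" for z
  have f_add: "f (x + y) = f x + f y" if "x \<in> Z" "y \<in> Z" for x y
    unfolding f_def coset_add[OF sB, symmetric] by (rule \<phi>(2)) (use that hom in auto)
  have f_scale: "f (a *\<^sub>R x) = a *\<^sub>R f x" if "x \<in> Z" for a x
    unfolding f_def coset_scale[OF sB, symmetric] by (rule \<phi>(3)) (use that hom in auto)
  have "f ` Z = {c. Poly_Mapping.keys c \<subseteq> alive bs t}"
    using bij_betw_imp_surj_on[OF \<phi>(1)] unfolding hom f_def by (simp add: image_image)
  moreover have fin: "finite (alive bs t)" by (simp add: alive_def)
  ultimately have "dim (f ` Z) = card (alive bs t)" using dim_keys[OF fin] by simp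
  moreover have "{z \<in> Z. f z = 0} = B"
  proof -
    have "f 0 = 0" using f_scale[of 0 0] subspace_0[OF sZ] by simp
    have "f z = 0 \<longleftrightarrow> z \<in> B" if "z \<in> Z" for z
    proof -
      have "f z = 0 \<longleftrightarrow> \<phi> (z +o B) = \<phi> (0 +o B)" using \<open>f 0 = 0\<close> by (simp add: f_def)
      also have "\<dots> \<longleftrightarrow> z +o B = 0 +o B"
        using that subspace_0[OF sZ] by (intro inj_on_eq_iff[OF bij_betw_imp_inj_on[OF \<phi>(1)]]) (unfold hom, blast+)
      also have "\<dots> \<longleftrightarrow> z \<in> B" using coset_eq_iff[OF sB, of z 0] by simp
      finally show ?thesis .
    qed
    then show ?thesis using BZ by blast
  qed
  moreover have "dim Z = dim (f ` Z) + dim {z \<in> Z. f z = 0}"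
    using order_trans[OF cycles_subset_chains chains_span[OF K]] finite_simplices[OF K]
    by (intro rank_nullity_subspace[OF sZ, of "(\<lambda>\<sigma>. Poly_Mapping.single \<sigma> 1) ` simplices k (X t)"] f_add f_scale)
      (auto simp: Z_def)
  ultimately show ?thesis by (simp add: betti_def B_def Z_def)
qed

subsection \<open>Barcodes\<close>

text \<open>The last hypothesis is closure under limits from the right. It puts the infimum into
  \<open>S\<close>, which is why bars contain their birth time and not their death time.\<close>

lemma upclosed_eq_atLeast_Inf:
  fixes S :: "real set"
  assumes "S \<noteq> {}" "S \<subseteq> {0..}" "\<And>s t. s \<in> S \<Longrightarrow> s \<le> t \<Longrightarrow> t \<in> S"
    and "\<And>t. 0 \<le> t \<Longrightarrow> (\<And>s. t < s \<Longrightarrow> s \<in> S) \<Longrightarrow> t \<in> S"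
  shows "S = {Inf S..}"
proof -
  have bdd: "bdd_below S" using assms(2) by (auto intro: bdd_belowI[of _ 0])
  have "0 \<le> Inf S" using assms(1,2) by (intro cInf_greatest) auto
  have "s \<in> S" if "Inf S < s" for s
    using that assms(3) cInf_less_iff[OF assms(1) bdd] by (meson less_imp_le)
  then have "Inf S \<in> S" using assms(4) \<open>0 \<le> Inf S\<close> by blast
  then show ?thesis using assms(3) cInf_lower[OF _ bdd] by auto
qed

text \<open>When \<open>E\<close> is adapted to \<open>S\<close>, the coordinates of a vector of
  \<open>S\<close> with respect to \<open>E\<close> are already those with respect to
  \<open>E \<inter> S\<close>.\<close>

lemma representation_subset_zero:
  fixes E :: "'a::real_vector set"
  assumes "independent E" "S = span (E \<inter> S)" "x \<in> S" "e \<notin> S"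
  shows "real_vector.representation E x e = 0"
proof -
  have "real_vector.representation E x = real_vector.representation (E \<inter> S) x"
    using assms by (intro real_vector.representation_extend) auto
  then show ?thesis using assms(4) real_vector.representation_ne_zero by (metis IntD2)
qed

text \<open>\<open>T\<close> is a time from which on the complex is constant, so the cycles of
  \<open>X T\<close> are the finite-dimensional space in which both chains of subspaces live.
  Together with \<open>mono\<close>, the form of \<open>right_cont\<close> says that the complex is
  constant on a short interval to the right of each time.\<close>

locale filtration =
  fixes X :: "real \<Rightarrow> 'v::linorder set set" and T :: real
  assumes complex: "finite_complex (X t)"
    and mono: "0 \<le> s \<Longrightarrow> s \<le> t \<Longrightarrow> X s \<subseteq> X t"
    and right_cont: "0 \<le> t \<Longrightarrow> \<exists>s>t. X s = X t"
    and limit: "0 \<le> T" "T \<le> t \<Longrightarrow> X t = X T"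
begin

definition birth :: "int \<Rightarrow> ('v set \<Rightarrow>\<^sub>0 real) \<Rightarrow> real" where
  "birth k e = Inf {t. 0 \<le> t \<and> e \<in> cycles k (X t)}"

definition death :: "int \<Rightarrow> ('v set \<Rightarrow>\<^sub>0 real) \<Rightarrow> ereal" where
  "death k e = (if \<exists>t\<ge>0. e \<in> boundaries k (X t)
     then ereal (Inf {t. 0 \<le> t \<and> e \<in> boundaries k (X t)}) else \<infinity>)"

lemma subset_limit: "0 \<le> t \<Longrightarrow> X t \<subseteq> X T"
  using mono[of t T] limit(2)[of t] by (cases "t \<le> T") auto

text \<open>For \<open>P\<close>, being a cycle and being a boundary are the intended properties:
  both pass to larger complexes.\<close>

lemma Collect_eq_atLeast_Inf:
  assumes "\<And>K L. K \<subseteq> L \<Longrightarrow> P K \<Longrightarrow> P L" "0 \<le> s" "P (X s)"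
  shows "{t. 0 \<le> t \<and> P (X t)} = {Inf {t. 0 \<le> t \<and> P (X t)}..}"
proof (rule upclosed_eq_atLeast_Inf)
  fix t assume t: "0 \<le> t" "\<And>s. t < s \<Longrightarrow> s \<in> {t. 0 \<le> t \<and> P (X t)}"
  obtain s where s: "t < s" "X s = X t" using right_cont[OF t(1)] by blast
  then have "P (X s)" using t(2)[of s] by blast
  then show "t \<in> {t. 0 \<le> t \<and> P (X t)}" using t(1) s(2) by simp
next
  fix s t assume st: "s \<in> {t. 0 \<le> t \<and> P (X t)}" "s \<le> t"
  then show "t \<in> {t. 0 \<le> t \<and> P (X t)}" using assms(1) mono[of s t] by auto
qed (use assms in auto)

lemma birth_le_iff:
  assumes "0 \<le> t" "e \<in> cycles k (X T)"
  shows "birth k e \<le> t \<longleftrightarrow> e \<in> cycles k (X t)"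
  using Collect_eq_atLeast_Inf[of "\<lambda>K. e \<in> cycles k K" T] cycles_mono[THEN subsetD] limit(1) assms
  unfolding birth_def by (metis (mono_tags, lifting) atLeast_iff mem_Collect_eq)

lemma birth_nonneg: "e \<in> cycles k (X T) \<Longrightarrow> 0 \<le> birth k e"
  unfolding birth_def using limit(1) by (intro cInf_greatest) auto

lemma less_death_iff:
  assumes "0 \<le> t"
  shows "ereal t < death k e \<longleftrightarrow> e \<notin> boundaries k (X t)"
proof (cases "\<exists>s\<ge>0. e \<in> boundaries k (X s)")
  case True
  then obtain s where s: "0 \<le> s" "e \<in> boundaries k (X s)" by blast
  have "Inf {t. 0 \<le> t \<and> e \<in> boundaries k (X t)} \<le> t \<longleftrightarrow> e \<in> boundaries k (X t)"
    using Collect_eq_atLeast_Inf[of "\<lambda>K. e \<in> boundaries k K", OF _ s] boundaries_mono[THEN subsetD] assms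
    by (metis (mono_tags, lifting) atLeast_iff mem_Collect_eq)
  then show ?thesis using True by (auto simp: death_def)
qed (use assms in \<open>auto simp: death_def\<close>)

lemma adapted_basis:
  obtains E where "finite E" "independent E" "span E = cycles k (X T)"
    and "\<And>t. 0 \<le> t \<Longrightarrow> span (E \<inter> cycles k (X t)) = cycles k (X t)"
    and "\<And>t. 0 \<le> t \<Longrightarrow> span (E \<inter> boundaries k (X t)) = boundaries k (X t)"
proof -
  have chain: "X s \<subseteq> X t \<or> X t \<subseteq> X s" if "0 \<le> s" "0 \<le> t" for s t
    using mono[of s t] mono[of t s] that by linarith
  have "\<exists>E. finite E \<and> independent E \<and> span E = cycles k (X T) \<and>
    (\<forall>S\<in>(\<lambda>t. cycles k (X t)) ` {0..} \<union> (\<lambda>t. boundaries k (X t)) ` {0..}. span (E \<inter> S) = S)"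
  proof (rule adapted_basis_exists)
    show "cycles k (X T) \<subseteq> span ((\<lambda>\<sigma>. Poly_Mapping.single \<sigma> (1::real)) ` simplices k (X T))"
      using cycles_subset_chains chains_span[OF complex] by blast
    show "\<forall>S\<in>(\<lambda>t. cycles k (X t)) ` {0..} \<union> (\<lambda>t. boundaries k (X t)) ` {0..}.
       subspace S \<and> S \<subseteq> cycles k (X T)"
      using cycles_mono[OF subset_limit, of _ k] boundaries_subset_cycles[OF complex, of k]
      by (auto simp: subspace_cycles subspace_boundaries)
    show "\<forall>S\<in>(\<lambda>t. cycles k (X t)) ` {0..}. \<forall>T\<in>(\<lambda>t. cycles k (X t)) ` {0..}. S \<subseteq> T \<or> T \<subseteq> S"
      by clarsimp (metis chain cycles_mono subsetD)
    show "\<forall>S\<in>(\<lambda>t. boundaries k (X t)) ` {0..}. \<forall>T\<in>(\<lambda>t. boundaries k (X t)) ` {0..}. S \<subseteq> T \<or> T \<subseteq> S"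
      by clarsimp (metis chain boundaries_mono subsetD)
  qed (simp_all add: subspace_cycles finite_simplices complex)
  then obtain E where "finite E" "independent E" "span E = cycles k (X T)"
    "\<forall>S\<in>(\<lambda>t. cycles k (X t)) ` {0..} \<union> (\<lambda>t. boundaries k (X t)) ` {0..}. span (E \<inter> S) = S"
    by blast
  then show thesis by (intro that[of E]) auto
qed

text \<open>In degree \<open>t\<close> the isomorphism reads off the coordinates of a cycle at the
  basis vectors alive at \<open>t\<close>. The coordinates it forgets belong to basis vectors that
  are boundaries already, which is exactly what passing to the quotient forgets.\<close>

theorem barcode_exists: "\<exists>bs. is_barcode k X bs"
proof -
  obtain E where E: "finite E" "independent E" "span E = cycles k (X T)"
    and EZ: "\<And>t. 0 \<le> t \<Longrightarrow> span (E \<inter> cycles k (X t)) = cycles k (X t)"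
    and EB: "\<And>t. 0 \<le> t \<Longrightarrow> span (E \<inter> boundaries k (X t)) = boundaries k (X t)"
    using adapted_basis by metis
  define rep where "rep = real_vector.representation E"
  define Z where "Z t = cycles k (X t)" for t
  define B where "B t = boundaries k (X t)" for t
  have sZ: "subspace (Z t)" and sB: "subspace (B t)" and BZ: "B t \<subseteq> Z t" for t
    by (auto simp: Z_def B_def subspace_cycles subspace_boundaries boundaries_subset_cycles[OF complex, THEN subsetD])
  have ZE: "Z t \<subseteq> span E" if "0 \<le> t" for t
    using E(3) cycles_mono[OF subset_limit[OF that]] by (simp add: Z_def)
  have B_mono: "B t \<subseteq> B (t + s)" and Z_mono: "Z t \<subseteq> Z (t + s)" if "0 \<le> t" "0 \<le> s" for s t
    using mono[of t "t + s"] that by (simp_all add: B_def Z_def boundaries_mono cycles_mono)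
  \<comment> \<open>A basis vector that is a boundary as soon as it is a cycle never contributes to
    homology and would give an empty bar.\<close>
  obtain es where es: "set es = {e \<in> E. ereal (birth k e) < death k e}" "distinct es"
    using finite_distinct_list[of "{e \<in> E. ereal (birth k e) < death k e}"] E(1) by auto
  define bs where "bs = map (\<lambda>e. (birth k e, death k e)) es"
  have EV: "e \<in> cycles k (X T)" if "e \<in> E" for e using that E(3) span_superset by blast
  have alive: "alive bs t = {i. i < length es \<and> es ! i \<in> Z t - B t}" if "0 \<le> t" for t
    using that es(1) EV nth_mem[of _ es]
    by (auto simp: alive_def bs_def Z_def B_def birth_le_iff less_death_iff)
  have fin: "finite (alive bs t)" for t by (simp add: alive_def)
  have ex_index: "\<exists>i\<in>alive bs t. es ! i = e" if "0 \<le> t" "e \<in> E" "e \<in> Z t" "e \<notin> B t" for e t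
  proof -
    have "ereal (birth k e) \<le> ereal t" using that EV birth_le_iff by (simp add: Z_def)
    also have "ereal t < death k e" using that less_death_iff by (simp add: B_def)
    finally have "e \<in> set es" using es(1) that by simp
    then obtain i where "i < length es" "es ! i = e" by (auto simp: in_set_conv_nth)
    then show ?thesis using that alive[OF that(1)] by auto
  qed
  define \<rho> where "\<rho> t z = (\<Sum>i\<in>alive bs t. Poly_Mapping.single i (rep z (es ! i)))" for t z
  have lookup_\<rho>: "Poly_Mapping.lookup (\<rho> t z) i = (if i \<in> alive bs t then rep z (es ! i) else 0)" for t z i
    unfolding \<rho>_def using fin by (simp add: lookup_sum lookup_single when_def)
  have rep_Z: "rep z e = 0" if "0 \<le> t" "z \<in> Z t" "e \<notin> Z t" for t z e
    unfolding rep_def using representation_subset_zero[OF E(2), of "Z t"] EZ that by (simp add: Z_def)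
  have rep_B: "rep z e = 0" if "0 \<le> t" "z \<in> B t" "e \<notin> B t" for t z e
    unfolding rep_def using representation_subset_zero[OF E(2), of "B t"] EB that by (simp add: B_def)
  have \<rho>_add: "\<rho> t (x + y) = \<rho> t x + \<rho> t y" if "0 \<le> t" "x \<in> Z t" "y \<in> Z t" for t x y
    using subsetD[OF ZE[OF that(1)] that(2)] subsetD[OF ZE[OF that(1)] that(3)]
    by (intro poly_mapping_eqI) (auto simp: lookup_\<rho> lookup_add rep_def real_vector.representation_add[OF E(2)])
  have \<rho>_scale: "\<rho> t (a *\<^sub>R x) = a *\<^sub>R \<rho> t x" if "0 \<le> t" "x \<in> Z t" for t x a
    using subsetD[OF ZE[OF that(1)] that(2)]
    by (intro poly_mapping_eqI) (auto simp: lookup_\<rho> rep_def real_vector.representation_scale[OF E(2)])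
  have \<rho>_B: "\<rho> t x = 0 \<longleftrightarrow> x \<in> B t" if t: "0 \<le> t" and x: "x \<in> Z t" for t x
  proof
    assume "x \<in> B t"
    then have "rep x (es ! i) = 0" if "i \<in> alive bs t" for i using that alive[OF t] rep_B[OF t] by blast
    then show "\<rho> t x = 0" by (intro poly_mapping_eqI) (simp add: lookup_\<rho>)
  next
    \<comment> \<open>A basis vector with a nonzero coordinate in \<open>x\<close> lies in
      \<open>Z t\<close>; were it outside \<open>B t\<close>, it would be alive and its coordinate
      would show up in \<open>\<rho> t x\<close>. So \<open>x\<close> is a combination of vectors in
      \<open>B t\<close>.\<close>
    assume "\<rho> t x = 0"
    then have 0: "rep x (es ! i) = 0" if "i \<in> alive bs t" for i
      using that lookup_\<rho>[of t x i] by simp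
    have "e \<in> B t" if "rep x e \<noteq> 0" for e
    proof (rule ccontr)
      assume "e \<notin> B t"
      moreover have "e \<in> E" using that real_vector.representation_ne_zero unfolding rep_def by blast
      moreover have "e \<in> Z t" using rep_Z[OF t x] that by blast
      ultimately show False using ex_index[OF t] 0 that by metis
    qed
    then have "(\<Sum>e | rep x e \<noteq> 0. rep x e *\<^sub>R e) \<in> B t"
      by (intro subspace_sum[OF sB] subspace_scale[OF sB]) auto
    moreover have "(\<Sum>e | rep x e \<noteq> 0. rep x e *\<^sub>R e) = x"
      unfolding rep_def using real_vector.sum_nonzero_representation_eq[OF E(2)] x ZE[OF t] by blast
    ultimately show "x \<in> B t" by simp
  qed
  have \<rho>_surj: "\<exists>z\<in>Z t. \<rho> t z = c" if t: "0 \<le> t" and c: "Poly_Mapping.keys c \<subseteq> alive bs t" for t c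
  proof
    let ?z = "\<Sum>i\<in>alive bs t. Poly_Mapping.lookup c i *\<^sub>R es ! i"
    show "?z \<in> Z t"
      by (intro subspace_sum[OF sZ] subspace_scale[OF sZ]) (use alive[OF t] in auto)
    have inE: "es ! i \<in> E" if "i \<in> alive bs t" for i
      using that alive[OF t] es(1) nth_mem[of i es] by auto
    have "rep ?z (es ! j) = Poly_Mapping.lookup c j" if j: "j \<in> alive bs t" for j
    proof -
      have "rep ?z = (\<lambda>b. \<Sum>i\<in>alive bs t. Poly_Mapping.lookup c i * rep (es ! i) b)"
        unfolding rep_def using inE E(2)
        by (subst real_vector.representation_sum)
          (auto simp: real_vector.representation_scale span_base span_scale)
      then have "rep ?z (es ! j) = (\<Sum>i\<in>alive bs t. Poly_Mapping.lookup c i * rep (es ! i) (es ! j))"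
        by simp
      also have "\<dots> = (\<Sum>i\<in>alive bs t. if i = j then Poly_Mapping.lookup c j else 0)"
      proof (rule sum.cong[OF refl])
        fix i assume i: "i \<in> alive bs t"
        have "es ! j = es ! i \<longleftrightarrow> i = j" using i j alive[OF t] es(2) by (auto simp: nth_eq_iff_index_eq)
        then show "Poly_Mapping.lookup c i * rep (es ! i) (es ! j) = (if i = j then Poly_Mapping.lookup c j else 0)"
          using real_vector.representation_basis[OF E(2) inE[OF i]] by (simp add: rep_def)
      qed
      finally show ?thesis using j fin by simp
    qed
    then show "\<rho> t ?z = c"
      using c by (intro poly_mapping_eqI) (auto simp: lookup_\<rho> in_keys_iff subset_iff)
  qed
  \<comment> \<open>The chosen representative does not matter, since \<open>\<rho> t\<close>
    vanishes on \<open>B t\<close>.\<close>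
  define \<phi> where "\<phi> t x = \<rho> t (SOME z. z \<in> Z t \<and> x = z +o B t)" for t x
  have \<phi>: "\<phi> t (z +o B t) = \<rho> t z" if t: "0 \<le> t" and z: "z \<in> Z t" for t z
  proof -
    define w where "w = (SOME w. w \<in> Z t \<and> z +o B t = w +o B t)"
    have w: "w \<in> Z t" "z +o B t = w +o B t"
      unfolding w_def using someI[of "\<lambda>w. w \<in> Z t \<and> z +o B t = w +o B t" z] z by auto
    then have "w - z \<in> B t" using coset_eq_iff[OF sB, of w t z] by simp
    moreover have "w - z \<in> Z t" using w(1) z sZ by (simp add: subspace_diff)
    ultimately have "\<rho> t (w - z) = 0" using \<rho>_B[OF t] by blast
    then have "\<rho> t w = \<rho> t z" using \<rho>_add[OF t z \<open>w - z \<in> Z t\<close>] by simp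
    then show ?thesis by (simp add: \<phi>_def w_def)
  qed
  have hom: "homology k (X t) = (\<lambda>z. z +o B t) ` Z t" for t by (simp add: homology_def B_def Z_def)
  have "graded_isomorphic (persistent_homology k X) (interval_sum bs)"
    unfolding graded_isomorphic_def
  proof (intro exI[of _ \<phi>] allI impI conjI ballI)
    fix t :: real assume t: "0 \<le> t"
    have "inj_on (\<phi> t) (homology k (X t))"
    proof (rule inj_onI)
      fix x y assume "x \<in> homology k (X t)" "y \<in> homology k (X t)" and eq: "\<phi> t x = \<phi> t y"
      then obtain z w where zw: "z \<in> Z t" "x = z +o B t" "w \<in> Z t" "y = w +o B t" by (auto simp: hom)
      then have "z - w \<in> Z t" using sZ by (simp add: subspace_diff)
      moreover have "\<rho> t w = \<rho> t z" using eq zw \<phi>[OF t] by simp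
      ultimately have "\<rho> t (z - w) = 0" using \<rho>_add[OF t \<open>w \<in> Z t\<close>, of "z - w"] by simp
      then show "x = y" using zw coset_eq_iff[OF sB] \<rho>_B[OF t \<open>z - w \<in> Z t\<close>] by blast
    qed
    moreover have "\<phi> t ` homology k (X t) = {c. Poly_Mapping.keys c \<subseteq> alive bs t}"
    proof -
      have "\<phi> t ` homology k (X t) = \<rho> t ` Z t" by (auto simp: hom \<phi>[OF t] image_image)
      also have "\<dots> = {c. Poly_Mapping.keys c \<subseteq> alive bs t}"
        using \<rho>_surj[OF t] by (fastforce simp: in_keys_iff lookup_\<rho> split: if_splits)
      finally show ?thesis .
    qed
    ultimately show "bij_betw (\<phi> t) (gcomp (persistent_homology k X) t) (gcomp (interval_sum bs) t)"
      by (simp add: bij_betw_def persistent_homology_def interval_sum_def)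
  next
    fix t :: real and x y assume t: "0 \<le> t"
      and "x \<in> gcomp (persistent_homology k X) t" "y \<in> gcomp (persistent_homology k X) t"
    then obtain z w where zw: "z \<in> Z t" "x = z +o B t" "w \<in> Z t" "y = w +o B t"
      by (auto simp: persistent_homology_def hom)
    then show "\<phi> t (gadd (persistent_homology k X) t x y) = gadd (interval_sum bs) t (\<phi> t x) (\<phi> t y)"
      using subspace_add[OF sZ, of z t w]
      by (simp add: persistent_homology_def interval_sum_def coset_add[OF sB] \<phi>[OF t] \<rho>_add[OF t])
  next
    fix t a :: real and x assume t: "0 \<le> t" and "x \<in> gcomp (persistent_homology k X) t"
    then obtain z where z: "z \<in> Z t" "x = z +o B t" by (auto simp: persistent_homology_def hom)
    then show "\<phi> t (gscale (persistent_homology k X) t a x) = gscale (interval_sum bs) t a (\<phi> t x)"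
      using subspace_scale[OF sZ, of z t a]
      by (simp add: persistent_homology_def interval_sum_def coset_scale[OF sB] \<phi>[OF t] \<rho>_scale[OF t]
          B_def[symmetric])
  next
    fix t s :: real and x assume t: "0 \<le> t" and s: "0 \<le> s" and "x \<in> gcomp (persistent_homology k X) t"
    then obtain z where z: "z \<in> Z t" "x = z +o B t" by (auto simp: persistent_homology_def hom)
    have "x + B (t + s) = z +o B (t + s)" using z coset_absorb[OF sB sB B_mono[OF t s]] by simp
    then have "\<phi> (t + s) (gshift (persistent_homology k X) s t x) = \<rho> (t + s) z"
      using \<phi>[of "t + s" z] t s z Z_mono[OF t s] by (auto simp: persistent_homology_def B_def[symmetric])
    also have "\<dots> = (\<Sum>i\<in>Poly_Mapping.keys (\<rho> t z) \<inter> alive bs (t + s).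
        Poly_Mapping.single i (Poly_Mapping.lookup (\<rho> t z) i))"
    proof (rule poly_mapping_eqI)
      fix i
      \<comment> \<open>A bar alive at \<open>t + s\<close> but not at \<open>t\<close> cannot have
        died by time \<open>t\<close>, so it is not born yet at \<open>t\<close>, and a cycle of
        \<open>X t\<close> has no coordinate there.\<close>
      have "rep z (es ! i) = 0" if "i \<in> alive bs (t + s)" "i \<notin> alive bs t"
        using that alive[of "t + s"] alive[OF t] t s B_mono[OF t s] rep_Z[OF t z(1)] by auto
      then show "Poly_Mapping.lookup (\<rho> (t + s) z) i = Poly_Mapping.lookup (\<Sum>i\<in>Poly_Mapping.keys (\<rho> t z) \<inter> alive bs (t + s).
        Poly_Mapping.single i (Poly_Mapping.lookup (\<rho> t z) i)) i"
        by (auto simp: lookup_sum lookup_single when_def in_keys_iff lookup_\<rho> fin)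
    qed
    finally show "\<phi> (t + s) (gshift (persistent_homology k X) s t x) = gshift (interval_sum bs) s t (\<phi> t x)"
      using z \<phi>[OF t] by (simp add: interval_sum_def)
  qed
  moreover have "0 \<le> b \<and> ereal b < d" if "(b, d) \<in> set bs" for b d
    using that es(1) EV birth_nonneg by (auto simp: bs_def)
  ultimately show ?thesis unfolding is_barcode_def by blast
qed

lemma is_barcode_barcode: "is_barcode k X (barcode k X)"
  unfolding barcode_def using barcode_exists someI_ex by metis

end

subsection \<open>Lifetime sums and expected Betti numbers\<close>

lemma integral_alive_interval:
  fixes b A :: real and d :: ereal
  assumes "0 \<le> b" "ereal b < d" "0 \<le> A"
  shows "set_integrable lborel {0..A} (\<lambda>t. indicator {t. b \<le> t \<and> ereal t < d} t :: real)"
    and "(LINT t:{0..A}|lborel. (indicator {t. b \<le> t \<and> ereal t < d} t :: real)) = real_of_ereal (min d (ereal A)) - min b A"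
proof -
  have "\<exists>S. S \<in> sets lborel \<and> emeasure lborel S < \<infinity> \<and> {0..A} \<inter> {t. b \<le> t \<and> ereal t < d} = S \<and>
     measure lborel S = real_of_ereal (min d (ereal A)) - min b A"
  proof (cases "d \<le> ereal A")
    case True
    then obtain d' where d': "d = ereal d'" using assms(2) by (cases d) auto
    have "{0..A} \<inter> {t. b \<le> t \<and> ereal t < d} = {b..<d'}" using d' True assms by auto
    then show ?thesis using d' True assms by (intro exI[of _ "{b..<d'}"]) auto
  next
    \<comment> \<open>If \<open>A < b\<close>, the interval \<open>{b..A}\<close> is empty and both
      sides of the length formula are 0.\<close>
    case False
    then have "ereal t < d" if "t \<le> A" for t
      using that by (meson ereal_less_eq(3) le_less_trans not_le)
    then have "{0..A} \<inter> {t. b \<le> t \<and> ereal t < d} = {b..A}" using assms by auto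
    moreover have "min d (ereal A) = ereal A" using False by (simp add: min_def)
    ultimately show ?thesis by (intro exI[of _ "{b..A}"]) (auto simp: min_def)
  qed
  then obtain S where S: "S \<in> sets lborel" "emeasure lborel S < \<infinity>"
    "{0..A} \<inter> {t. b \<le> t \<and> ereal t < d} = S"
    "measure lborel S = real_of_ereal (min d (ereal A)) - min b A" by blast
  have *: "(\<lambda>t. indicator {0..A} t *\<^sub>R (indicator {t. b \<le> t \<and> ereal t < d} t :: real)) = indicator S"
    unfolding S(3)[symmetric] by (auto simp: indicator_def)
  show "set_integrable lborel {0..A} (\<lambda>t. indicator {t. b \<le> t \<and> ereal t < d} t :: real)"
    unfolding set_integrable_def * using S by simp
  show "(LINT t:{0..A}|lborel. (indicator {t. b \<le> t \<and> ereal t < d} t :: real)) = real_of_ereal (min d (ereal A)) - min b A"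
    unfolding set_lebesgue_integral_def * using S by simp
qed

lemma sum_list_truncated_eq_integral:
  assumes "\<forall>(b, d)\<in>set bs. 0 \<le> b \<and> ereal b < d" "0 \<le> A"
  shows "(\<Sum>(b, d)\<leftarrow>bs. real_of_ereal (min d (ereal A)) - min b A)
    = (LINT t:{0..A}|lborel. real (card (alive bs t)))"
proof -
  have bd: "0 \<le> fst (bs ! i)" "ereal (fst (bs ! i)) < snd (bs ! i)" if "i < length bs" for i
    using assms(1) nth_mem[OF that] by (auto simp: case_prod_beta)
  have "real (card (alive bs t)) = (\<Sum>i<length bs. indicator {t. fst (bs ! i) \<le> t \<and> ereal t < snd (bs ! i)} t)" for t
  proof -
    have "alive bs t = {i\<in>{..<length bs}. t \<in> {t. fst (bs ! i) \<le> t \<and> ereal t < snd (bs ! i)}}"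
      by (auto simp: alive_def)
    then show ?thesis by (simp add: indicator_def of_bool_def[symmetric] sum.If_cases Int_def)
  qed
  then have "(LINT t:{0..A}|lborel. real (card (alive bs t)))
    = (\<Sum>i<length bs. (LINT t:{0..A}|lborel. indicator {t. fst (bs ! i) \<le> t \<and> ereal t < snd (bs ! i)} t))"
    using integral_alive_interval(1)[OF bd assms(2)]
    unfolding set_lebesgue_integral_def set_integrable_def
    by (simp only: scaleR_sum_right) (rule Bochner_Integration.integral_sum, simp)
  also have "\<dots> = (\<Sum>i<length bs. real_of_ereal (min (snd (bs ! i)) (ereal A)) - min (fst (bs ! i)) A)"
    using integral_alive_interval(2)[OF bd assms(2)] by (intro sum.cong) auto
  also have "\<dots> = (\<Sum>(b, d)\<leftarrow>bs. real_of_ereal (min d (ereal A)) - min b A)"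
    by (simp add: sum_list_sum_nth case_prod_beta atLeast0LessThan)
  finally show ?thesis by simp
qed

lemma truncated_bar_le:
  assumes "0 \<le> b" "ereal b < d" "0 \<le> A"
  shows "0 \<le> real_of_ereal (min d (ereal A)) - min b A"
    and "ennreal (real_of_ereal (min d (ereal A)) - min b A) \<le> e2ennreal (d - ereal b)"
proof -
  have "0 \<le> real_of_ereal (min d (ereal A)) - min b A \<and>
    ennreal (real_of_ereal (min d (ereal A)) - min b A) \<le> e2ennreal (d - ereal b)"
  proof (cases d)
    case (real r)
    then have "min d (ereal A) = ereal (min r A)" by (simp add: min_def)
    then show ?thesis using real assms by (auto simp: min_def e2ennreal_ereal intro!: ennreal_leI)
  next
    case PInf
    then have "min d (ereal A) = ereal A" "d - ereal b = \<infinity>" by (simp_all add: min_def)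
    then show ?thesis using assms by (simp add: min_def e2ennreal_infty)
  qed (use assms in auto)
  then show "0 \<le> real_of_ereal (min d (ereal A)) - min b A"
    and "ennreal (real_of_ereal (min d (ereal A)) - min b A) \<le> e2ennreal (d - ereal b)" by auto
qed

lemma sum_list_truncated_le:
  assumes "\<forall>(b, d)\<in>set bs. 0 \<le> b \<and> ereal b < d" "0 \<le> A"
  shows "0 \<le> (\<Sum>(b, d)\<leftarrow>bs. real_of_ereal (min d (ereal A)) - min b A) \<and>
    ennreal (\<Sum>(b, d)\<leftarrow>bs. real_of_ereal (min d (ereal A)) - min b A)
    \<le> (\<Sum>(b, d)\<leftarrow>bs. e2ennreal (d - ereal b))"
  using assms(1)
proof (induction bs)
  case (Cons x bs)
  obtain b d where x: "x = (b, d)" by (cases x)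
  have bd: "0 \<le> b" "ereal b < d" using Cons.prems x by auto
  show ?case
    using Cons truncated_bar_le[OF bd assms(2)] unfolding x
    by (auto simp: ennreal_plus intro!: add_mono add_nonneg_nonneg simp del: ennreal_plus[symmetric])
qed simp

lemma (in filtration) truncated_lifetime_sum_eq_integral:
  assumes "0 \<le> A"
  shows "truncated_lifetime_sum k X A = (LINT t:{0..A}|lborel. betti k (X t))"
proof -
  have bs: "is_barcode k X (barcode k X)" by (rule is_barcode_barcode)
  then have "truncated_lifetime_sum k X A = (LINT t:{0..A}|lborel. real (card (alive (barcode k X) t)))"
    unfolding truncated_lifetime_sum_def is_barcode_def
    using assms by (intro sum_list_truncated_eq_integral) auto
  also have "\<dots> = (LINT t:{0..A}|lborel. betti k (X t))"
    using card_alive_eq_betti[OF complex bs] by (intro set_lebesgue_integral_cong) auto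
  finally show ?thesis .
qed

lemma (in filtration) truncated_lifetime_sum_le:
  assumes "0 \<le> A"
  shows "0 \<le> truncated_lifetime_sum k X A"
    and "ennreal (truncated_lifetime_sum k X A) \<le> lifetime_sum k X"
  using sum_list_truncated_le[of "barcode k X" A] is_barcode_barcode[of k] assms
  unfolding truncated_lifetime_sum_def lifetime_sum_def is_barcode_def by auto

section \<open>The random complex: filtration property and expected face counts\<close>

lemma finite_nonempty_subsets: "finite V \<Longrightarrow> finite (nonempty_subsets V)"
  by (simp add: nonempty_subsets_def)

lemma finite_complex_complex_filtration:
  assumes "finite V"
  shows "finite_complex (complex_filtration V u \<omega> t)"
proof -
  have "finite \<sigma> \<and> (\<forall>\<tau>\<subseteq>\<sigma>. \<tau> \<noteq> {} \<longrightarrow> \<tau> \<in> complex_filtration V u \<omega> t)"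
    if \<sigma>: "\<sigma> \<in> complex_filtration V u \<omega> t" for \<sigma>
  proof
    have "\<sigma> \<subseteq> V" using \<sigma> by (auto simp: complex_filtration_def nonempty_subsets_def)
    then show "finite \<sigma>" using assms finite_subset by blast
    have "u \<rho> \<omega> \<le> t" if "\<rho> \<noteq> {}" "\<rho> \<subseteq> \<sigma>" for \<rho>
      using \<sigma> that by (auto simp: complex_filtration_def)
    then show "\<forall>\<tau>\<subseteq>\<sigma>. \<tau> \<noteq> {} \<longrightarrow> \<tau> \<in> complex_filtration V u \<omega> t"
      using \<open>\<sigma> \<subseteq> V\<close> by (auto simp: complex_filtration_def nonempty_subsets_def)
  qed
  moreover have "finite (complex_filtration V u \<omega> t)"
    using finite_nonempty_subsets[OF assms] by (simp add: complex_filtration_def)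
  ultimately show ?thesis by (simp add: finite_complex_def)
qed

lemma complex_filtration_cong:
  assumes "\<And>\<tau>. \<tau> \<in> nonempty_subsets V \<Longrightarrow> u \<tau> \<omega> \<le> s \<longleftrightarrow> u \<tau> \<omega> \<le> t"
  shows "complex_filtration V u \<omega> s = complex_filtration V u \<omega> t"
proof -
  have "u \<tau> \<omega> \<le> s \<longleftrightarrow> u \<tau> \<omega> \<le> t" if "\<sigma> \<in> nonempty_subsets V" "\<tau> \<noteq> {}" "\<tau> \<subseteq> \<sigma>" for \<sigma> \<tau>
    using that by (intro assms) (auto simp: nonempty_subsets_def)
  then show ?thesis by (auto simp: complex_filtration_def)
qed

text \<open>For a fixed outcome only finitely many values \<open>u \<tau> \<omega>\<close> occur,
  and the complex changes only at these. The limit time is their maximum, with 0 inserted to cover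
  an empty vertex set and to keep it nonnegative.\<close>

lemma filtration_complex_filtration:
  fixes V :: "'v::linorder set"
  assumes "finite V"
  obtains T where "filtration (complex_filtration V u \<omega>) T"
proof -
  define F where "F = (\<lambda>\<tau>. u \<tau> \<omega>) ` nonempty_subsets V"
  have F: "finite F" using finite_nonempty_subsets[OF assms] by (simp add: F_def)
  have uF: "u \<tau> \<omega> \<in> F" if "\<tau> \<in> nonempty_subsets V" for \<tau> using that by (simp add: F_def)
  have "filtration (complex_filtration V u \<omega>) (Max (insert 0 F))"
  proof
    fix s t :: real assume "s \<le> t"
    then show "complex_filtration V u \<omega> s \<subseteq> complex_filtration V u \<omega> t"
      unfolding complex_filtration_def by clarsimp (meson order_trans)
  next
    fix t :: real
    \<comment> \<open>Halfway to the next value after \<open>t\<close>; \<open>t + 1\<close> stands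
      in if there is none.\<close>
    define s where "s = (t + Min (insert (t + 1) {x \<in> F. t < x})) / 2"
    have "t < Min (insert (t + 1) {x \<in> F. t < x})" using F by (subst Min_gr_iff) auto
    then have s: "t < s" "s < Min (insert (t + 1) {x \<in> F. t < x})" by (auto simp: s_def)
    then have "\<not> x \<le> s" if "x \<in> F" "t < x" for x
      using that F by (auto simp: Min_gr_iff)
    then have "complex_filtration V u \<omega> s = complex_filtration V u \<omega> t"
      using uF s(1) by (intro complex_filtration_cong) force
    then show "\<exists>s>t. complex_filtration V u \<omega> s = complex_filtration V u \<omega> t" using s(1) by blast
  next
    show "0 \<le> Max (insert 0 F)" using F by simp
  next
    fix t assume t: "Max (insert 0 F) \<le> t"
    have "x \<le> Max (insert 0 F)" if "x \<in> F" for x using F that by simp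
    then show "complex_filtration V u \<omega> t = complex_filtration V u \<omega> (Max (insert 0 F))"
      using t uF by (intro complex_filtration_cong) (meson order_trans)
  qed (simp add: finite_complex_complex_filtration assms)
  then show thesis by (rule that)
qed

lemma multiparameter_processD:
  assumes "multiparameter_process p V M u"
  shows "prob_space M" "finite V" "prob_space.indep_vars M (\<lambda>_. borel) u (nonempty_subsets V)"
    and "\<sigma> \<in> nonempty_subsets V \<Longrightarrow> u \<sigma> \<in> borel_measurable M"
    and "\<sigma> \<in> nonempty_subsets V \<Longrightarrow> real_distribution (distr M borel (u \<sigma>))"
    and "\<sigma> \<in> nonempty_subsets V \<Longrightarrow> cdf (distr M borel (u \<sigma>)) t = p (card \<sigma> - 1) t"
proof -
  show ps: "prob_space M" and "finite V"
    and ind: "prob_space.indep_vars M (\<lambda>_. borel) u (nonempty_subsets V)"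
    using assms by (auto simp: multiparameter_process_def)
  show m: "u \<sigma> \<in> borel_measurable M" if "\<sigma> \<in> nonempty_subsets V"
    using ind that by (simp add: prob_space.indep_vars_def[OF ps])
  show "real_distribution (distr M borel (u \<sigma>))" if "\<sigma> \<in> nonempty_subsets V"
    using prob_space.real_distribution_distr[OF ps m[OF that]] .
  show "cdf (distr M borel (u \<sigma>)) t = p (card \<sigma> - 1) t" if "\<sigma> \<in> nonempty_subsets V"
    using assms that by (auto simp: multiparameter_process_def)
qed

text \<open>Group the faces by dimension: a set of \<open>m\<close> vertices has
  \<open>m choose (i + 1)\<close> faces of dimension \<open>i\<close>.\<close>

lemma prod_nonempty_subsets:
  assumes "finite \<sigma>"
  shows "(\<Prod>\<tau>\<in>nonempty_subsets \<sigma>. p (card \<tau> - 1) t) = qfun p (int (card \<sigma>) - 1) t"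
proof -
  have "(\<Prod>\<tau>\<in>nonempty_subsets \<sigma>. p (card \<tau> - 1) t)
    = (\<Prod>i<card \<sigma>. \<Prod>\<tau>\<in>{\<tau>\<in>nonempty_subsets \<sigma>. card \<tau> - 1 = i}. p (card \<tau> - 1) t)"
  proof (rule prod.group[symmetric])
    show "(\<lambda>\<tau>. card \<tau> - 1) ` nonempty_subsets \<sigma> \<subseteq> {..<card \<sigma>}"
    proof
      fix i assume "i \<in> (\<lambda>\<tau>. card \<tau> - 1) ` nonempty_subsets \<sigma>"
      then obtain \<tau> where \<tau>: "\<tau> \<subseteq> \<sigma>" "\<tau> \<noteq> {}" "i = card \<tau> - 1" by (auto simp: nonempty_subsets_def)
      moreover have "card \<tau> \<noteq> 0" using \<tau>(2) finite_subset[OF \<tau>(1) assms] by simp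
      ultimately show "i \<in> {..<card \<sigma>}" using card_mono[OF assms \<tau>(1)] by simp
    qed
  qed (simp_all add: finite_nonempty_subsets assms)
  also have "\<dots> = (\<Prod>i<card \<sigma>. p i t ^ (card \<sigma> choose (i + 1)))"
  proof (rule prod.cong[OF refl])
    fix i
    have "\<tau> \<noteq> {} \<and> card \<tau> - 1 = i \<longleftrightarrow> card \<tau> = i + 1" if "\<tau> \<subseteq> \<sigma>" for \<tau>
    proof -
      have "\<tau> \<noteq> {} \<longleftrightarrow> card \<tau> \<noteq> 0" using finite_subset[OF that assms] by (metis card_0_eq)
      then show ?thesis by arith
    qed
    then have "{\<tau>\<in>nonempty_subsets \<sigma>. card \<tau> - 1 = i} = {\<tau>. \<tau> \<subseteq> \<sigma> \<and> card \<tau> = i + 1}"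
      unfolding nonempty_subsets_def by blast
    then show "(\<Prod>\<tau>\<in>{\<tau>\<in>nonempty_subsets \<sigma>. card \<tau> - 1 = i}. p (card \<tau> - 1) t) = p i t ^ (card \<sigma> choose (i + 1))"
      using n_subsets[OF assms, of "i + 1"] by simp
  qed
  finally show ?thesis by (simp add: qfun_def)
qed

text \<open>The empty simplex is always present and is treated uniformly here, because for
  \<open>k = 0\<close> the Morse inequality involves dimension -1.\<close>

lemma simplex_event:
  assumes "\<sigma> \<subseteq> V"
  shows "\<sigma> \<in> insert {} (complex_filtration V u \<omega> t) \<longleftrightarrow> (\<forall>\<tau>\<in>nonempty_subsets \<sigma>. u \<tau> \<omega> \<le> t)"
proof (cases "\<sigma> = {}")
  case False
  then have "\<sigma> \<in> insert {} (complex_filtration V u \<omega> t) \<longleftrightarrow> (\<forall>\<tau>. \<tau> \<noteq> {} \<and> \<tau> \<subseteq> \<sigma> \<longrightarrow> u \<tau> \<omega> \<le> t)"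
    using assms by (simp add: complex_filtration_def nonempty_subsets_def)
  then show ?thesis unfolding nonempty_subsets_def by blast
qed (simp add: nonempty_subsets_def)

lemma
  assumes P: "multiparameter_process p V M u" and \<sigma>: "\<sigma> \<subseteq> V"
  shows sets_simplex: "{\<omega> \<in> space M. \<sigma> \<in> insert {} (complex_filtration V u \<omega> t)} \<in> sets M"
    and prob_simplex: "measure M {\<omega> \<in> space M. \<sigma> \<in> insert {} (complex_filtration V u \<omega> t)}
      = qfun p (int (card \<sigma>) - 1) t"
proof -
  interpret prob_space M using P by (rule multiparameter_processD)
  let ?S = "{\<omega> \<in> space M. \<sigma> \<in> insert {} (complex_filtration V u \<omega> t)}"
  have "finite \<sigma>" using multiparameter_processD(2)[OF P] \<sigma> finite_subset by blast
  have "?S \<in> sets M \<and> prob ?S = qfun p (int (card \<sigma>) - 1) t"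
  proof (cases "\<sigma> = {}")
    case True
    then show ?thesis by (simp add: qfun_def prob_space)
  next
    case False
    define J where "J = nonempty_subsets \<sigma>"
    have J: "finite J" "J \<noteq> {}" "J \<subseteq> nonempty_subsets V"
      using \<open>finite \<sigma>\<close> False \<sigma> by (auto simp: J_def nonempty_subsets_def)
    have S: "?S = (\<Inter>\<tau>\<in>J. u \<tau> -` {..t} \<inter> space M)"
      using J(2) unfolding simplex_event[OF \<sigma>] J_def[symmetric] by auto
    have um: "u \<tau> \<in> borel_measurable M" if "\<tau> \<in> J" for \<tau>
      using that J multiparameter_processD(4)[OF P] by blast
    have "prob (u \<tau> -` {..t} \<inter> space M) = p (card \<tau> - 1) t" if "\<tau> \<in> J" for \<tau>
    proof -
      have "cdf (distr M borel (u \<tau>)) t = p (card \<tau> - 1) t"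
        using that J multiparameter_processD(6)[OF P] by blast
      then show ?thesis using um[OF that] by (simp add: cdf_def measure_distr)
    qed
    then have "prob ?S = (\<Prod>\<tau>\<in>J. p (card \<tau> - 1) t)"
      unfolding S using indep_varsD[OF multiparameter_processD(3)[OF P] J(2,1,3), of "\<lambda>_. {..t}"] by simp
    moreover have "?S \<in> sets M"
      unfolding S using J um by (intro sets.finite_INT) (auto intro: measurable_sets)
    ultimately show ?thesis using prod_nonempty_subsets[OF \<open>finite \<sigma>\<close>] by (simp add: J_def)
  qed
  then show "?S \<in> sets M" "prob ?S = qfun p (int (card \<sigma>) - 1) t" by auto
qed

text \<open>Stated by the number \<open>m\<close> of vertices, so that \<open>m = 0\<close> covers
  dimension -1; the proof is linearity of expectation over the \<open>m\<close>-subsets.\<close>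

lemma
  assumes P: "multiparameter_process p V M u"
  shows integrable_card_simplices:
      "integrable M (\<lambda>\<omega>. real (card (simplices (int m - 1) (complex_filtration V u \<omega> t))))"
    and expectation_card_simplices:
      "(LINT \<omega>|M. real (card (simplices (int m - 1) (complex_filtration V u \<omega> t))))
        = real (card V choose m) * qfun p (int m - 1) t"
proof -
  interpret prob_space M using P by (rule multiparameter_processD)
  have V: "finite V" using P by (rule multiparameter_processD)
  define \<S> where "\<S> = {\<sigma>. \<sigma> \<subseteq> V \<and> card \<sigma> = m}"
  have \<S>: "finite \<S>" "card \<S> = card V choose m"
    using V n_subsets[OF V] by (auto simp: \<S>_def)
  define A where "A \<sigma> = {\<omega> \<in> space M. \<sigma> \<in> insert {} (complex_filtration V u \<omega> t)}" for \<sigma>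
  have eq: "real (card (simplices (int m - 1) (complex_filtration V u \<omega> t))) = (\<Sum>\<sigma>\<in>\<S>. indicator (A \<sigma>) \<omega>)"
    if "\<omega> \<in> space M" for \<omega>
  proof -
    have "simplices (int m - 1) (complex_filtration V u \<omega> t) = {\<sigma>\<in>\<S>. \<omega> \<in> A \<sigma>}"
      using that by (auto simp: simplices_def \<S>_def A_def complex_filtration_def nonempty_subsets_def)
    then show ?thesis using \<S>(1) by (simp add: indicator_def of_bool_def[symmetric] sum.If_cases Int_def)
  qed
  have A: "A \<sigma> \<in> sets M" "prob (A \<sigma>) = qfun p (int m - 1) t" if "\<sigma> \<in> \<S>" for \<sigma>
    using that sets_simplex[OF P] prob_simplex[OF P] by (auto simp: \<S>_def A_def)
  have "integrable M (\<lambda>\<omega>. \<Sum>\<sigma>\<in>\<S>. indicator (A \<sigma>) \<omega> :: real)"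
    using A(1) by (intro Bochner_Integration.integrable_sum) (simp add: emeasure_eq_measure)
  then show "integrable M (\<lambda>\<omega>. real (card (simplices (int m - 1) (complex_filtration V u \<omega> t))))"
    using eq by (subst Bochner_Integration.integrable_cong[OF refl]) auto
  have "(LINT \<omega>|M. real (card (simplices (int m - 1) (complex_filtration V u \<omega> t))))
    = (LINT \<omega>|M. (\<Sum>\<sigma>\<in>\<S>. indicator (A \<sigma>) \<omega>))"
    using eq by (intro Bochner_Integration.integral_cong) auto
  also have "\<dots> = (\<Sum>\<sigma>\<in>\<S>. LINT \<omega>|M. indicator (A \<sigma>) \<omega>)"
    using A(1) by (intro Bochner_Integration.integral_sum) (simp add: emeasure_eq_measure)
  also have "\<dots> = (\<Sum>\<sigma>\<in>\<S>. qfun p (int m - 1) t)"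
    using A by (intro sum.cong) (auto simp: sets.Int_space_eq2)
  finally show "(LINT \<omega>|M. real (card (simplices (int m - 1) (complex_filtration V u \<omega> t))))
        = real (card V choose m) * qfun p (int m - 1) t"
    using \<S>(2) by simp
qed

text \<open>The complex takes finitely many values and the target carries the discrete structure, so
  every function of the complex, in particular its Betti number, becomes jointly measurable in
  outcome and time.\<close>

lemma measurable_complex_filtration:
  assumes P: "multiparameter_process p V M u"
  shows "(\<lambda>x. complex_filtration V u (fst x) (snd x)) \<in> measurable (M \<Otimes>\<^sub>M lborel) (count_space (Pow (Pow V)))"
proof -
  have V: "finite V" using P by (rule multiparameter_processD)
  let ?N = "M \<Otimes>\<^sub>M lborel :: ('b \<times> real) measure"
  have ev: "{x \<in> space ?N. \<sigma> \<in> complex_filtration V u (fst x) (snd x)} \<in> sets ?N" if "\<sigma> \<in> Pow V" for \<sigma>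
  proof -
    have fin: "finite (nonempty_subsets \<sigma>)"
      using that V finite_subset finite_nonempty_subsets by blast
    have "{x \<in> space ?N. u \<tau> (fst x) \<le> snd x} \<in> sets ?N" if "\<tau> \<in> nonempty_subsets \<sigma>" for \<tau>
    proof -
      have [measurable]: "u \<tau> \<in> borel_measurable M"
        using that \<open>\<sigma> \<in> Pow V\<close> by (intro multiparameter_processD(4)[OF P]) (auto simp: nonempty_subsets_def)
      show ?thesis by measurable
    qed
    then have "{x \<in> space ?N. \<forall>\<tau>\<in>nonempty_subsets \<sigma>. u \<tau> (fst x) \<le> snd x} \<in> sets ?N"
      using fin by (intro sets.sets_Collect_finite_All) auto
    moreover have "\<sigma> \<in> complex_filtration V u (fst x) (snd x) \<longleftrightarrow>
        \<sigma> \<noteq> {} \<and> (\<forall>\<tau>\<in>nonempty_subsets \<sigma>. u \<tau> (fst x) \<le> snd x)" for x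
      using that by (auto simp: complex_filtration_def nonempty_subsets_def)
    ultimately show ?thesis by (cases "\<sigma> = {}") auto
  qed
  have "(\<lambda>x. complex_filtration V u (fst x) (snd x)) -` {K} \<inter> space ?N \<in> sets ?N" if "K \<in> Pow (Pow V)" for K
  proof -
    have "(\<lambda>x. complex_filtration V u (fst x) (snd x)) -` {K} \<inter> space ?N
      = {x \<in> space ?N. \<forall>\<sigma>\<in>Pow V. \<sigma> \<in> complex_filtration V u (fst x) (snd x) \<longleftrightarrow> \<sigma> \<in> K}"
    proof -
      have "complex_filtration V u \<omega> t \<subseteq> Pow V" for \<omega> t
        by (auto simp: complex_filtration_def nonempty_subsets_def)
      then have "complex_filtration V u \<omega> t = K \<longleftrightarrow>
          (\<forall>\<sigma>\<in>Pow V. \<sigma> \<in> complex_filtration V u \<omega> t \<longleftrightarrow> \<sigma> \<in> K)" for \<omega> t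
        using that by blast
      then show ?thesis by auto
    qed
    also have "\<dots> \<in> sets ?N"
    proof (rule sets.sets_Collect_finite_All')
      fix \<sigma> assume \<sigma>: "\<sigma> \<in> Pow V"
      have "{x \<in> space ?N. \<sigma> \<notin> complex_filtration V u (fst x) (snd x)} \<in> sets ?N"
        using ev[OF \<sigma>] by (rule sets.sets_Collect_neg)
      then show "{x \<in> space ?N. \<sigma> \<in> complex_filtration V u (fst x) (snd x) \<longleftrightarrow> \<sigma> \<in> K} \<in> sets ?N"
        using ev[OF \<sigma>] by (cases "\<sigma> \<in> K") auto
    qed (use V in auto)
    finally show ?thesis .
  qed
  then show ?thesis
    using V by (subst measurable_count_space_eq2) (auto simp: complex_filtration_def nonempty_subsets_def)
qed

text \<open>Betti numbers are bounded by the number of subsets of \<open>V\<close>, so over a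
  bounded time interval Fubini's theorem exchanges expectation and integration in time.\<close>

lemma
  fixes k :: int and A :: real and u :: "'v::linorder set \<Rightarrow> 'a \<Rightarrow> real"
  assumes P: "multiparameter_process p V M u" and A: "0 \<le> A"
  shows integrable_betti: "integrable M (\<lambda>\<omega>. betti k (complex_filtration V u \<omega> t))"
    and integrable_truncated_lifetime_sum:
      "integrable M (\<lambda>\<omega>. truncated_lifetime_sum k (complex_filtration V u \<omega>) A)"
    and set_integrable_expectation_betti:
      "set_integrable lborel {0..A} (\<lambda>t. LINT \<omega>|M. betti k (complex_filtration V u \<omega> t))"
    and expectation_truncated_lifetime_sum:
      "(LINT \<omega>|M. truncated_lifetime_sum k (complex_filtration V u \<omega>) A)
        = (LINT t:{0..A}|lborel. LINT \<omega>|M. betti k (complex_filtration V u \<omega> t))"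
proof -
  interpret prob_space M using P by (rule multiparameter_processD)
  interpret pair_sigma_finite M "lborel :: real measure" ..
  have V: "finite V" using P by (rule multiparameter_processD)
  define b where "b \<omega> t = betti k (complex_filtration V u \<omega> t)" for \<omega> t
  have [measurable]: "(\<lambda>x. b (fst x) (snd x)) \<in> borel_measurable (M \<Otimes>\<^sub>M lborel)"
    unfolding b_def by (rule measurable_compose[OF measurable_complex_filtration[OF P]]) simp
  have bound: "\<bar>b \<omega> t\<bar> \<le> real (card (Pow V))" for \<omega> t
  proof -
    have "card (simplices k (complex_filtration V u \<omega> t)) \<le> card (Pow V)"
      using V by (intro card_mono) (auto simp: simplices_def complex_filtration_def nonempty_subsets_def)
    then show ?thesis
      using betti_le[OF finite_complex_complex_filtration[OF V], of k u \<omega> t]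
        betti_nonneg[OF finite_complex_complex_filtration[OF V], of k u \<omega> t] by (simp add: b_def)
  qed
  have bt: "(\<lambda>\<omega>. b \<omega> t) \<in> borel_measurable M" for t
    using measurable_compose[of "\<lambda>\<omega>. (\<omega>, t)" M "M \<Otimes>\<^sub>M lborel" "\<lambda>x. b (fst x) (snd x)" borel] by simp
  show "integrable M (\<lambda>\<omega>. betti k (complex_filtration V u \<omega> t))"
    using bt bound unfolding b_def by (intro integrable_const_bound[of _ "real (card (Pow V))"]) auto
  \<comment> \<open>The indicator confines a bounded function to a set of finite product
    measure.\<close>
  define f where "f \<omega> t = indicator {0..A} t *\<^sub>R b \<omega> t" for \<omega> t
  have f: "integrable (M \<Otimes>\<^sub>M lborel) (case_prod f)"
  proof (rule integrableI_bounded_set[where A = "space M \<times> {0..A}" and B = "real (card (Pow V))"])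
    show "space M \<times> {0..A} \<in> sets (M \<Otimes>\<^sub>M lborel)" by auto
    show "case_prod f \<in> borel_measurable (M \<Otimes>\<^sub>M lborel)"
      unfolding f_def case_prod_beta by measurable
    show "emeasure (M \<Otimes>\<^sub>M lborel) (space M \<times> {0..A}) < \<infinity>"
      using A by (simp add: lborel.emeasure_pair_measure_Times emeasure_space_1)
    show "AE x in M \<Otimes>\<^sub>M lborel. x \<in> space M \<times> {0..A} \<longrightarrow> norm (case_prod f x) \<le> real (card (Pow V))"
      using bound by (intro AE_I2) (auto simp: f_def indicator_def)
    show "AE x in M \<Otimes>\<^sub>M lborel. x \<notin> space M \<times> {0..A} \<longrightarrow> case_prod f x = 0"
      by (intro AE_I2) (auto simp: f_def space_pair_measure indicator_def)
  qed
  have L: "truncated_lifetime_sum k (complex_filtration V u \<omega>) A = (LINT t|lborel. f \<omega> t)" for \<omega>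
  proof -
    obtain T where "filtration (complex_filtration V u \<omega>) T"
      by (rule filtration_complex_filtration[OF V])
    from filtration.truncated_lifetime_sum_eq_integral[OF this A] show ?thesis
      by (simp add: set_lebesgue_integral_def f_def b_def)
  qed
  show "integrable M (\<lambda>\<omega>. truncated_lifetime_sum k (complex_filtration V u \<omega>) A)"
    unfolding L using integrable_fst[OF f] .
  have E: "(LINT \<omega>|M. f \<omega> t) = indicator {0..A} t *\<^sub>R (LINT \<omega>|M. betti k (complex_filtration V u \<omega> t))" for t
    by (simp add: f_def b_def)
  show "set_integrable lborel {0..A} (\<lambda>t. LINT \<omega>|M. betti k (complex_filtration V u \<omega> t))"
    using integrable_snd[OF f] unfolding E set_integrable_def .
  show "(LINT \<omega>|M. truncated_lifetime_sum k (complex_filtration V u \<omega>) A)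
        = (LINT t:{0..A}|lborel. LINT \<omega>|M. betti k (complex_filtration V u \<omega> t))"
    unfolding L Fubini_integral[OF f, symmetric] E set_lebesgue_integral_def ..
qed

lemma expectation_betti_ge:
  assumes P: "multiparameter_process p V M u"
  shows "real (card V choose (k + 1)) * qfun p k t - real (card V choose (k + 2)) * qfun p (k + 1) t
    - real (card V choose k) * qfun p (int k - 1) t
    \<le> (LINT \<omega>|M. betti k (complex_filtration V u \<omega> t))"
proof -
  have V: "finite V" using P by (rule multiparameter_processD)
  let ?f = "\<lambda>j \<omega>. real (card (simplices j (complex_filtration V u \<omega> t)))"
  have i: "integrable M (?f k)" "integrable M (?f (int k + 1))" "integrable M (?f (int k - 1))"
    using integrable_card_simplices[OF P, of "k + 1" t] integrable_card_simplices[OF P, of "k + 2" t]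
      integrable_card_simplices[OF P, of k t] by (simp_all add: add.commute)
  have "(LINT \<omega>|M. ?f k \<omega> - ?f (int k + 1) \<omega> - ?f (int k - 1) \<omega>) \<le> (LINT \<omega>|M. betti k (complex_filtration V u \<omega> t))"
    using i integrable_betti[OF P order_refl]
    by (intro integral_mono) (auto intro!: morse_inequality finite_complex_complex_filtration V)
  then show ?thesis
    using i expectation_card_simplices[OF P, of "k + 1" t] expectation_card_simplices[OF P, of "k + 2" t]
      expectation_card_simplices[OF P, of k t] by (simp add: add.commute)
qed

subsection \<open>The lower bound\<close>

locale cdf_family =
  fixes p :: "nat \<Rightarrow> real \<Rightarrow> real"
  assumes mono: "s \<le> t \<Longrightarrow> p i s \<le> p i t"
    and nonneg: "0 \<le> p i t"
    and le_1: "p i t \<le> 1"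
    and at_top: "(p i \<longlongrightarrow> 1) at_top"
begin

lemma qfun_nonneg: "0 \<le> qfun p k t" and qfun_le_1: "qfun p k t \<le> 1"
  unfolding qfun_def by (intro prod_nonneg prod_le_1; simp add: nonneg le_1 power_le_one)+

lemma qfun_mono: "s \<le> t \<Longrightarrow> qfun p k s \<le> qfun p k t"
  unfolding qfun_def by (intro prod_mono conjI power_mono mono zero_le_power nonneg)

lemma rfun_nonneg: "0 \<le> rfun p k t"
  unfolding rfun_def by (intro prod_nonneg; simp add: nonneg)

lemma rfun_mono: "s \<le> t \<Longrightarrow> rfun p k s \<le> rfun p k t"
  unfolding rfun_def by (intro prod_mono conjI power_mono mono zero_le_power nonneg)

lemma rfun_at_top: "(rfun p k \<longlongrightarrow> 1) at_top"
proof -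
  have "((\<lambda>t. \<Prod>i\<le>nat (k + 1). p i t ^ (nat (k + 1) choose i)) \<longlongrightarrow> (\<Prod>i\<le>nat (k + 1). 1 ^ (nat (k + 1) choose i))) at_top"
    by (intro tendsto_prod tendsto_power at_top)
  then show ?thesis by (simp add: rfun_def[abs_def])
qed

lemma borel_measurable_qfun [measurable]: "qfun p k \<in> borel_measurable borel"
  by (intro borel_measurable_mono monoI qfun_mono)

text \<open>For \<open>u < 1\<close> the infimum in \<open>rcheck\<close> is over a nonempty set
  because \<open>rfun\<close> tends to 1; without this bound it could be the unspecified infimum of
  the empty set.\<close>

lemma rcheck_set_nonempty:
  assumes "u < 1"
  shows "{t. 0 \<le> t \<and> u < rfun p k t} \<noteq> {}"
proof -
  have "\<forall>\<^sub>F t in at_top. u < rfun p k t \<and> 0 \<le> t"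
    using order_tendstoD(1)[OF rfun_at_top assms] eventually_ge_at_top[of 0] by eventually_elim simp
  then show ?thesis using eventually_happens'[OF trivial_limit_at_top_linorder] by blast
qed

lemma rcheck_set_bdd: "bdd_below {t. 0 \<le> t \<and> u < rfun p k t}"
  by (auto intro: bdd_belowI[of _ 0])

lemma rcheck_nonneg: "u < 1 \<Longrightarrow> 0 \<le> rcheck p k u"
  unfolding rcheck_def using rcheck_set_nonempty by (intro cInf_greatest) auto

lemma rcheck_mono: "u \<le> v \<Longrightarrow> v < 1 \<Longrightarrow> rcheck p k u \<le> rcheck p k v"
  unfolding rcheck_def using rcheck_set_nonempty[of v k] rcheck_set_bdd
  by (intro cInf_superset_mono) auto

text \<open>This lemma and \<open>rfun_le\<close> leave out the time \<open>rcheck p k u\<close>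
  itself, where \<open>rfun\<close> may jump; a single time is negligible in the integrals.\<close>

lemma rfun_gt:
  assumes "u < 1" "rcheck p k u < t"
  shows "u < rfun p k t"
proof -
  obtain s where "s < t" "u < rfun p k s"
    using assms rcheck_set_nonempty[OF assms(1)] unfolding rcheck_def by (auto simp: cInf_less_iff rcheck_set_bdd)
  then show ?thesis using rfun_mono[of s t k] by simp
qed

lemma rfun_le:
  assumes "0 \<le> t" "t < rcheck p k u"
  shows "rfun p k t \<le> u"
  using assms cInf_lower[OF _ rcheck_set_bdd, of t u k] unfolding rcheck_def by (auto simp: not_less[symmetric])

text \<open>Pascal's rule in the exponents. Enlarging a set of \<open>m\<close> vertices by one adds
  \<open>m choose i\<close> new faces of dimension \<open>i\<close>, so \<open>rfun\<close> is the
  probability that all faces through the new vertex are present.\<close>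

lemma qfun_Suc: "qfun p (int m) t = qfun p (int m - 1) t * rfun p (int m - 1) t"
proof -
  have m: "nat (int m + 1) = Suc m" "nat (int m - 1 + 1) = m" by simp_all
  have "qfun p (int m) t = (\<Prod>i\<le>m. p i t ^ (m choose (i + 1)) * p i t ^ (m choose i))"
    by (simp add: qfun_def m lessThan_Suc_atMost power_add mult.commute)
  also have "\<dots> = (\<Prod>i\<le>m. p i t ^ (m choose (i + 1))) * rfun p (int m - 1) t"
    by (simp add: rfun_def prod.distrib)
  \<comment> \<open>The extra index \<open>m\<close> contributes the exponent
    \<open>m choose (m + 1) = 0\<close>.\<close>
  also have "(\<Prod>i\<le>m. p i t ^ (m choose (i + 1))) = qfun p (int m - 1) t"
    by (simp add: qfun_def lessThan_Suc_atMost[symmetric] binomial_eq_0)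
  finally show ?thesis .
qed

lemma set_integrable_qfun: "set_integrable lborel {0..t} (qfun p k)"
  unfolding set_integrable_def
  by (rule integrableI_bounded_set_indicator[where B = 1])
    (auto simp: qfun_nonneg qfun_le_1 emeasure_lborel_Icc_eq)

lemma Qfun_mono:
  assumes "s \<le> t"
  shows "Qfun p k s \<le> Qfun p k t"
  unfolding Qfun_def set_lebesgue_integral_def
  using set_integrable_qfun[of s k] set_integrable_qfun[of t k] assms qfun_nonneg[of k] unfolding set_integrable_def
  by (intro integral_mono) (auto simp: indicator_def)

lemma Qfun_nonneg: "0 \<le> Qfun p k t"
  unfolding Qfun_def set_lebesgue_integral_def by (intro Bochner_Integration.integral_nonneg) (simp add: qfun_nonneg)

lemma Phi_mono: "u \<le> v \<Longrightarrow> v < 1 \<Longrightarrow> Phi p k u \<le> Phi p k v"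
  unfolding Phi_def by (intro Qfun_mono rcheck_mono)

end

section \<open>Bounds for a fixed number of vertices\<close>

lemma binomial_Suc_real:
  assumes "m \<le> n"
  shows "real (n choose Suc m) * (real m + 1) = real (n choose m) * (real n - real m)"
proof -
  have "Suc m * (n choose Suc m) = (n - m) * (n choose m)"
    by (metis binomial_absorption binomial_absorb_comp)
  then have "real (Suc m * (n choose Suc m)) = real ((n - m) * (n choose m))" by presburger
  then show ?thesis using assms by (simp add: of_nat_diff algebra_simps)
qed

text \<open>Both subtracted face counts are measured against the main term
  \<open>C * qfun p k t\<close>. Above, \<open>q_(k+1) = q_k * r_k\<close> loses a factor
  \<open>b / n\<close>, while the binomial coefficient gains at most \<open>n / (k + 2)\<close>.
  Below, \<open>q_(k-1) * (a / n)\<close> is at most \<open>q_(k-1) * r_(k-1) = q_k\<close>, and the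
  ratio of binomial coefficients is \<open>(k + 1) / (n - k)\<close>; this is where the factor
  \<open>n / (n - k)\<close> arises.\<close>

lemma expectation_betti_ge_qfun:
  assumes P: "multiparameter_process p V M u" and p: "cdf_family p"
    and a: "0 < a" "a / real n \<le> rfun p (int k - 1) t" and b: "rfun p k t \<le> b / real n"
    and n: "n = card V" "k < n"
  shows "real (n choose (k + 1)) * (1 - b / (real k + 2) - (real k + 1) / a * (real n / (real n - real k))) * qfun p k t
    \<le> (LINT \<omega>|M. betti k (complex_filtration V u \<omega> t))"
proof -
  interpret cdf_family p by (rule p)
  define C where "C = real (n choose (k + 1))"
  have C: "0 \<le> C" by (simp add: C_def)
  have n0: "real n > 0" "real k < real n" using n by auto
  have C2: "real (n choose (k + 2)) * (real k + 2) = C * (real n - real k - 1)"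
    using binomial_Suc_real[of "k + 1" n] n by (simp add: C_def algebra_simps)
  have C0: "real (n choose k) = C * (real k + 1) / (real n - real k)"
    using binomial_Suc_real[of k n] n0 n by (simp add: C_def field_simps)
  have q: "0 \<le> qfun p k t" by (rule qfun_nonneg)
  have "real (n choose (k + 2)) * qfun p (k + 1) t = real (n choose (k + 2)) * qfun p k t * rfun p k t"
    using qfun_Suc[of "k + 1" t] by (simp add: add.commute)
  also have "\<dots> \<le> real (n choose (k + 2)) * qfun p k t * (b / real n)"
    by (intro mult_left_mono b mult_nonneg_nonneg q) simp
  also have "\<dots> \<le> C * real n / (real k + 2) * qfun p k t * (b / real n)"
  proof -
    have "0 \<le> b / real n" using b rfun_nonneg order_trans by blast
    moreover have "real (n choose (k + 2)) \<le> C * real n / (real k + 2)"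
      using C2 mult_left_mono[of "real n - real k - 1" "real n" C] C by (simp add: pos_le_divide_eq)
    ultimately show ?thesis using q by (intro mult_right_mono) auto
  qed
  also have "\<dots> = C * (b / (real k + 2)) * qfun p k t" using n0 by simp
  finally have 2: "real (n choose (k + 2)) * qfun p (k + 1) t \<le> C * (b / (real k + 2)) * qfun p k t" .
  have "qfun p (int k - 1) t * (a / real n) \<le> qfun p k t"
    unfolding qfun_Suc[of k] by (intro mult_left_mono a qfun_nonneg)
  then have "qfun p (int k - 1) t \<le> qfun p k t * real n / a"
    using a n0 by (simp add: field_simps)
  then have "real (n choose k) * qfun p (int k - 1) t \<le> real (n choose k) * (qfun p k t * real n / a)"
    by (intro mult_left_mono) auto
  also have "\<dots> = C * ((real k + 1) / a * (real n / (real n - real k))) * qfun p k t"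
    unfolding C0 by (simp add: mult_ac)
  finally have "C * (1 - b / (real k + 2) - (real k + 1) / a * (real n / (real n - real k))) * qfun p k t
    \<le> C * qfun p k t - real (n choose (k + 2)) * qfun p (k + 1) t - real (n choose k) * qfun p (int k - 1) t"
    using 2 by (simp add: algebra_simps)
  also have "\<dots> \<le> (LINT \<omega>|M. betti k (complex_filtration V u \<omega> t))"
    using expectation_betti_ge[OF P, of k t] by (simp add: C_def n)
  finally show ?thesis by (simp add: C_def)
qed

text \<open>The comparison function is \<open>q_k\<close> times the difference of the indicators of
  \<open>{0..y}\<close> and \<open>{0..x}\<close>. Apart from \<open>t = y\<close>, it is at most 0
  outside the open interval from \<open>x\<close> to \<open>y\<close>, where nonnegativity of Betti
  numbers suffices; hence the order of \<open>x\<close> and \<open>y\<close> does not matter. The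
  separate \<open>\<delta>\<close> allows a constant independent of \<open>n\<close>.\<close>

lemma expectation_truncated_lifetime_sum_ge:
  fixes u :: "'v::linorder set \<Rightarrow> 'a \<Rightarrow> real" and A :: real and k :: nat
  assumes P: "multiparameter_process p V M u" and p: "cdf_family p"
    and a: "0 < a" "a / real n < 1" and b: "0 \<le> b" "b / real n < 1" and n: "n = card V" "k < n"
    and A: "rcheck p k (b / real n) \<le> A"
    and \<delta>: "0 \<le> \<delta>" "\<delta> \<le> 1 - b / (real k + 2) - (real k + 1) / a * (real n / (real n - real k))"
  shows "real (n choose (k + 1)) * \<delta> * (Phi p k (b / real n) - Psi p k (a / real n))
    \<le> (LINT \<omega>|M. truncated_lifetime_sum k (complex_filtration V u \<omega>) A)"
proof -
  interpret cdf_family p by (rule p)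
  interpret prob_space M using P by (rule multiparameter_processD)
  define C where "C = real (n choose (k + 1)) * \<delta>"
  define x where "x = rcheck p (int k - 1) (a / real n)"
  define y where "y = rcheck p k (b / real n)"
  define e where "e t = (LINT \<omega>|M. betti k (complex_filtration V u \<omega> t))" for t
  have C: "0 \<le> C" using \<delta> by (simp add: C_def)
  have e_nonneg: "0 \<le> e t" for t
    unfolding e_def
    by (intro Bochner_Integration.integral_nonneg betti_nonneg finite_complex_complex_filtration multiparameter_processD(2)[OF P])
  have y: "0 \<le> y" "y \<le> A" using A b(2) rcheck_nonneg by (auto simp: y_def)
  have bound: "C * qfun p k t \<le> e t" if "x < t" "t < y" "0 \<le> t" for t
  proof -
    have "C * qfun p k t \<le> real (n choose (k + 1)) * (1 - b / (real k + 2) - (real k + 1) / a * (real n / (real n - real k))) * qfun p k t"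
      unfolding C_def by (intro mult_right_mono mult_left_mono \<delta> qfun_nonneg) simp
    also have "\<dots> \<le> e t"
      unfolding e_def using rfun_gt[OF a(2), of "int k - 1" t] rfun_le[of t k "b / real n"] that n a(1)
      by (intro expectation_betti_ge_qfun[OF P p]) (auto simp: x_def y_def)
    finally show ?thesis .
  qed
  have i: "set_integrable lborel {0..A} e"
    unfolding e_def using set_integrable_expectation_betti[OF P, of A] y by simp
  have "C * (Qfun p k y - Qfun p k x)
    = (LINT t|lborel. C * (indicator {0..y} t *\<^sub>R qfun p k t - indicator {0..x} t *\<^sub>R qfun p k t))"
    using set_integrable_qfun[of y k] set_integrable_qfun[of x k]
    unfolding Qfun_def set_lebesgue_integral_def set_integrable_def by simp
  also have "\<dots> \<le> (LINT t|lborel. indicator {0..A} t *\<^sub>R e t)"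
  proof (rule integral_mono_AE)
    show "integrable lborel (\<lambda>t. C * (indicator {0..y} t *\<^sub>R qfun p k t - indicator {0..x} t *\<^sub>R qfun p k t))"
      using set_integrable_qfun[of y k] set_integrable_qfun[of x k] unfolding set_integrable_def
      by (intro integrable_mult_right Bochner_Integration.integrable_diff)
    show "integrable lborel (\<lambda>t. indicator {0..A} t *\<^sub>R e t)" using i by (simp add: set_integrable_def)
    have "C * (indicator {0..y} t *\<^sub>R qfun p k t - indicator {0..x} t *\<^sub>R qfun p k t) \<le> indicator {0..A} t *\<^sub>R e t"
      if "t \<noteq> y" for t \<comment> \<open>at \<open>t = y\<close> the bound on \<open>rfun p k t\<close> may fail\<close>
    proof (cases "0 \<le> t \<and> x < t \<and> t < y")
      case True
      then show ?thesis using bound y by simp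
    next
      case False
      then have "indicator {0..y} t *\<^sub>R qfun p k t - indicator {0..x} t *\<^sub>R qfun p k t \<le> 0"
        using that qfun_nonneg[of k t] by (auto simp: indicator_def)
      then show ?thesis
        using mult_nonneg_nonpos[OF C] e_nonneg[of t] by (meson indicator_pos_le order_trans scaleR_nonneg_nonneg)
    qed
    then show "AE t in lborel. C * (indicator {0..y} t *\<^sub>R qfun p k t - indicator {0..x} t *\<^sub>R qfun p k t)
        \<le> indicator {0..A} t *\<^sub>R e t"
      using AE_lborel_singleton[of y] by (rule_tac AE_mp) auto
  qed
  also have "\<dots> = (LINT \<omega>|M. truncated_lifetime_sum k (complex_filtration V u \<omega>) A)"
    using expectation_truncated_lifetime_sum[OF P, of A] y by (simp add: set_lebesgue_integral_def e_def)
  finally show ?thesis by (simp add: C_def Phi_def Psi_def x_def y_def)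
qed

text \<open>Each \<open>p i\<close> is realised as the distribution function of the top simplex of
  the process on \<open>i + 1\<close> vertices.\<close>

lemma cdf_family_process:
  assumes "\<And>n. card (V n) = n \<and> multiparameter_process p (V n) (M n) (u n)"
  shows "cdf_family p"
proof -
  have "\<exists>D. real_distribution D \<and> p i = cdf D" for i
  proof -
    have P: "multiparameter_process p (V (Suc i)) (M (Suc i)) (u (Suc i))" and c: "card (V (Suc i)) = Suc i"
      using assms by auto
    have "V (Suc i) \<in> nonempty_subsets (V (Suc i))" using c by (auto simp: nonempty_subsets_def)
    from multiparameter_processD(5,6)[OF P this] show ?thesis
      using c by (intro exI[of _ "distr (M (Suc i)) borel (u (Suc i) (V (Suc i)))"]) auto
  qed
  then obtain D where D: "real_distribution (D i)" "p i = cdf (D i)" for i by metis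
  have fb: "finite_borel_measure (D i)" for i using D(1) by (rule real_distribution.finite_borel_measure_M)
  show ?thesis
    by standard (auto simp: D(2) finite_borel_measure.cdf_nondecreasing[OF fb] finite_borel_measure.cdf_nonneg[OF fb]
        real_distribution.cdf_bounded_prob[OF D(1)] real_distribution.cdf_lim_at_top_prob[OF D(1)])
qed

lemma expected_truncated_lifetime_sum_lower_bound:
  fixes k :: nat
    and p :: "nat \<Rightarrow> real \<Rightarrow> real"
    and V :: "nat \<Rightarrow> 'v::linorder set"
    and M :: "nat \<Rightarrow> 'a measure"
    and u :: "nat \<Rightarrow> 'v set \<Rightarrow> 'a \<Rightarrow> real"
    and u0 B D :: real
  assumes process: "\<And>n. card (V n) = n \<and> multiparameter_process p (V n) (M n) (u n)"
    and u0: "0 < u0" "u0 < 1"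
    and B: "1 < B"
    and D: "0 \<le> D" "D < (real k + 2) / (4 * (real k + 1))"
    and Phi_Psi: "\<And>x. 0 \<le> x \<Longrightarrow> x \<le> u0 \<Longrightarrow> Phi p k (D * x) \<ge> B * Psi p k x"
  shows "\<exists>c>0. \<forall>T>rcheck p k 0. \<forall>\<^sub>F n in sequentially.
            (LINT \<omega>|M n. truncated_lifetime_sum k (complex_filtration (V n) (u n) \<omega>) T)
              \<ge> c * real n ^ (k + 1) * Phi p k (1 / real n)"
proof -
  have p: "cdf_family p" using process by (rule cdf_family_process)
  interpret cdf_family p by (rule p)
  define b where "b = (real k + 2) / 2"
  \<comment> \<open>Enlarging \<open>D\<close> preserves the hypothesis, while \<open>D = 0\<close> would give \<open>a = b / 0 = 0\<close>; \<open>1 / 8\<close> is below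
     the bound on \<open>D\<close> for every \<open>k\<close>.\<close>
  define E where "E = max D (1 / 8)"
  \<comment> \<open>Chosen so that \<open>E * (a / n) = b / n\<close>, the argument of
    \<open>Phi\<close> at the end of the time window.\<close>
  define a where "a = b / E"
  have b: "1 \<le> b" by (simp add: b_def)
  have "1 / 8 < (real k + 2) / (4 * (real k + 1))" by (simp add: field_simps)
  then have E: "0 < E" "D \<le> E" "E < (real k + 2) / (4 * (real k + 1))"
    using D by (auto simp: E_def)
  \<comment> \<open>Then \<open>b / n = E * (a / n)\<close> stays below 1 once
    \<open>a / n < u0\<close>, as monotonicity of \<open>Phi\<close> demands.\<close>
  have "E \<le> 1"
  proof -
    have "(real k + 2) / (4 * (real k + 1)) \<le> 1" by (simp add: field_simps)
    then show ?thesis using E by linarith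
  qed
  have a: "0 < a" using E b by (simp add: a_def)
  define \<gamma> where "\<gamma> = 1 - b / (real k + 2) - (real k + 1) / a"
  have "b / (real k + 2) = 1 / 2" by (simp add: b_def)
  moreover have "(real k + 1) / a = 2 * (real k + 1) / (real k + 2) * E"
    using E by (simp add: a_def b_def)
  moreover have "2 * (real k + 1) / (real k + 2) * E < 2 * (real k + 1) / (real k + 2) * ((real k + 2) / (4 * (real k + 1)))"
    using E by (intro mult_strict_left_mono) auto
  moreover have "2 * (real k + 1) / (real k + 2) * ((real k + 2) / (4 * (real k + 1))) = 1 / 2"
    by (simp add: divide_simps)
  ultimately have \<gamma>: "0 < \<gamma>" unfolding \<gamma>_def by linarith
  \<comment> \<open>Halving \<open>\<gamma>\<close> leaves room for the limit of
    \<open>n / (n - k)\<close>, the factor \<open>1 - 1 / B\<close> is the share of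
    \<open>Phi\<close> left after subtracting \<open>Psi\<close>, and the denominator comes from
    \<open>(n / (k + 1)) ^ (k + 1) \<le> n choose (k + 1)\<close>. None of this involves
    \<open>T\<close>.\<close>
  define c where "c = \<gamma> / 2 * (1 - 1 / B) / (real k + 1) ^ (k + 1)"
  have c: "0 < c" using \<gamma> B by (simp add: c_def)
  have "\<forall>\<^sub>F n in sequentially. c * real n ^ (k + 1) * Phi p k (1 / real n)
      \<le> (LINT \<omega>|M n. truncated_lifetime_sum k (complex_filtration (V n) (u n) \<omega>) T)"
    if T: "rcheck p k 0 < T" for T
  proof -
    \<comment> \<open>Once \<open>b / n < rfun p k s\<close>, the time window ends by
      \<open>s\<close>, hence before \<open>T\<close>; this is what \<open>T > rcheck p k 0\<close>
      provides.\<close>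
    obtain s where s: "0 \<le> s" "s < T" "0 < rfun p k s"
      using T rcheck_set_nonempty[of 0 k] unfolding rcheck_def by (auto simp: cInf_less_iff rcheck_set_bdd)
    have "(\<lambda>n. 1 - b / (real k + 2) - (real k + 1) / a * (real n / (real n - real k))) \<longlonglongrightarrow>
        1 - b / (real k + 2) - (real k + 1) / a * 1"
      by (intro tendsto_diff tendsto_mult tendsto_const) real_asymp
    then have ev\<gamma>: "\<forall>\<^sub>F n in sequentially. \<gamma> / 2 < 1 - b / (real k + 2) - (real k + 1) / a * (real n / (real n - real k))"
      by (rule order_tendstoD(1)) (use \<gamma> in \<open>simp add: \<gamma>_def[symmetric]\<close>)
    have "(\<lambda>n. a / real n) \<longlonglongrightarrow> 0" by real_asymp
    then have eva: "\<forall>\<^sub>F n in sequentially. a / real n < u0" using u0 by (intro order_tendstoD(2))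
    have "(\<lambda>n. b / real n) \<longlonglongrightarrow> 0" by real_asymp
    then have evb: "\<forall>\<^sub>F n in sequentially. b / real n < min 1 (rfun p k s)" using s by (intro order_tendstoD(2)) auto
    show ?thesis
      using ev\<gamma> eva evb eventually_gt_at_top[of k]
    proof eventually_elim
      case (elim n)
      have n: "0 < real n" "k < n" using elim by auto
      have P: "multiparameter_process p (V n) (M n) (u n)" "n = card (V n)" using process by auto
      let ?\<Phi> = "Phi p k (b / real n)"
      have "B * Psi p k (a / real n) \<le> Phi p k (D * (a / real n))"
        using elim a n by (intro Phi_Psi) auto
      also have "\<dots> \<le> Phi p k (E * (a / real n))"
      proof (rule Phi_mono)
        show "D * (a / real n) \<le> E * (a / real n)" using E a n by (intro mult_right_mono) auto
        show "E * (a / real n) < 1" using E elim by (simp add: a_def)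
      qed
      also have "E * (a / real n) = b / real n" using E by (simp add: a_def)
      finally have "Psi p k (a / real n) \<le> ?\<Phi> / B" using B by (simp add: field_simps)
      then have gap: "(1 - 1 / B) * ?\<Phi> \<le> ?\<Phi> - Psi p k (a / real n)" by (simp add: algebra_simps)
      have "rcheck p k (b / real n) \<le> s"
        using s elim rcheck_set_bdd unfolding rcheck_def by (intro cInf_lower) auto
      then have "real (n choose (k + 1)) * (\<gamma> / 2) * (?\<Phi> - Psi p k (a / real n))
          \<le> (LINT \<omega>|M n. truncated_lifetime_sum k (complex_filtration (V n) (u n) \<omega>) T)"
        using elim s b a u0 less_trans[OF elim(2) u0(2)] \<gamma> P by (intro expectation_truncated_lifetime_sum_ge[OF P(1) p]) auto
      moreover have "c * real n ^ (k + 1) * Phi p k (1 / real n)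
          \<le> real (n choose (k + 1)) * (\<gamma> / 2) * (?\<Phi> - Psi p k (a / real n))"
      proof -
        have "Phi p k (1 / real n) \<le> ?\<Phi>"
          using b n elim by (intro Phi_mono divide_right_mono) auto
        then have "c * real n ^ (k + 1) * Phi p k (1 / real n) \<le> c * real n ^ (k + 1) * ?\<Phi>"
          using c by (intro mult_left_mono) auto
        also have "\<dots> = (real n / real (k + 1)) ^ (k + 1) * ((\<gamma> / 2) * ((1 - 1 / B) * ?\<Phi>))"
          by (simp add: c_def power_divide mult_ac add.commute)
        also have "\<dots> \<le> real (n choose (k + 1)) * ((\<gamma> / 2) * ((1 - 1 / B) * ?\<Phi>))"
          using binomial_ge_n_over_k_pow_k[of "k + 1" n, where 'a = real] n \<gamma> B
          by (intro mult_right_mono mult_nonneg_nonneg) (auto simp: Phi_def Qfun_nonneg)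
        also have "\<dots> \<le> real (n choose (k + 1)) * ((\<gamma> / 2) * (?\<Phi> - Psi p k (a / real n)))"
          using gap \<gamma> by (intro mult_left_mono) auto
        finally show ?thesis by (simp add: mult.assoc)
      qed
      ultimately show ?case by linarith
    qed
  qed
  then show ?thesis using c by blast
qed

theorem theorem4p4:
  fixes k :: nat
    and p :: "nat \<Rightarrow> real \<Rightarrow> real"
    and V :: "nat \<Rightarrow> 'v::linorder set"
    and M :: "nat \<Rightarrow> 'a measure"
    and u :: "nat \<Rightarrow> 'v set \<Rightarrow> 'a \<Rightarrow> real"
    and u0 B D :: real
  assumes process: "\<And>n. card (V n) = n \<and> multiparameter_process p (V n) (M n) (u n)"
    and u0: "0 < u0" "u0 < 1"
    and B: "1 < B"
    and D: "0 \<le> D" "D < (real k + 2) / (4 * (real k + 1))"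
    and Phi_Psi: "\<And>x. 0 \<le> x \<Longrightarrow> x \<le> u0 \<Longrightarrow> Phi p k (D * x) \<ge> B * Psi p k x"
  shows "(\<exists>c>0. \<forall>T>rcheck p k 0. \<forall>\<^sub>F n in sequentially.
            (LINT \<omega>|M n. truncated_lifetime_sum k (complex_filtration (V n) (u n) \<omega>) T)
              \<ge> c * real n ^ (k + 1) * Phi p k (1 / real n)) \<and>
         (\<exists>C::real>0. \<forall>\<^sub>F n in sequentially.
            ennreal (real n ^ (k + 1) * Phi p k (1 / real n))
              \<le> ennreal C * (\<integral>\<^sup>+ \<omega>. lifetime_sum k (complex_filtration (V n) (u n) \<omega>) \<partial>M n))"
proof (intro conjI)
  interpret cdf_family p using process by (rule cdf_family_process)
  show 1: "\<exists>c>0. \<forall>T>rcheck p k 0. \<forall>\<^sub>F n in sequentially.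
            (LINT \<omega>|M n. truncated_lifetime_sum k (complex_filtration (V n) (u n) \<omega>) T)
              \<ge> c * real n ^ (k + 1) * Phi p k (1 / real n)"
    using assms by (rule expected_truncated_lifetime_sum_lower_bound)
  \<comment> \<open>Any time beyond \<open>rcheck p k 0\<close> would serve; truncation only
    shortens bars, so the full lifetime sum inherits the bound.\<close>
  define T where "T = rcheck p k 0 + 1"
  have T: "0 \<le> T" "rcheck p k 0 < T" using rcheck_nonneg[of 0 k] by (auto simp: T_def)
  obtain c where c: "0 < c" "\<forall>\<^sub>F n in sequentially. c * real n ^ (k + 1) * Phi p k (1 / real n)
      \<le> (LINT \<omega>|M n. truncated_lifetime_sum k (complex_filtration (V n) (u n) \<omega>) T)"
    using 1 T by blast
  have "\<forall>\<^sub>F n in sequentially. ennreal (real n ^ (k + 1) * Phi p k (1 / real n))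
      \<le> ennreal (1 / c) * (\<integral>\<^sup>+ \<omega>. lifetime_sum k (complex_filtration (V n) (u n) \<omega>) \<partial>M n)"
    using c(2)
  proof eventually_elim
    case (elim n)
    let ?L = "\<lambda>\<omega>. truncated_lifetime_sum k (complex_filtration (V n) (u n) \<omega>) T"
    have P: "multiparameter_process p (V n) (M n) (u n)" using process by simp
    have L: "0 \<le> ?L \<omega>" "ennreal (?L \<omega>) \<le> lifetime_sum k (complex_filtration (V n) (u n) \<omega>)" for \<omega>
    proof -
      obtain t where t: "filtration (complex_filtration (V n) (u n) \<omega>) t"
        by (rule filtration_complex_filtration[OF multiparameter_processD(2)[OF P]])
      show "0 \<le> ?L \<omega>" "ennreal (?L \<omega>) \<le> lifetime_sum k (complex_filtration (V n) (u n) \<omega>)"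
        using filtration.truncated_lifetime_sum_le[OF t T(1)] by auto
    qed
    have "ennreal (real n ^ (k + 1) * Phi p k (1 / real n)) \<le> ennreal (1 / c * (LINT \<omega>|M n. ?L \<omega>))"
      using elim c(1) by (intro ennreal_leI) (simp add: field_simps)
    also have "\<dots> = ennreal (1 / c) * ennreal (LINT \<omega>|M n. ?L \<omega>)"
      using c(1) L(1) by (intro ennreal_mult Bochner_Integration.integral_nonneg) auto
    also have "ennreal (LINT \<omega>|M n. ?L \<omega>) = (\<integral>\<^sup>+ \<omega>. ennreal (?L \<omega>) \<partial>M n)"
      using integrable_truncated_lifetime_sum[OF P T(1)] L(1) by (intro nn_integral_eq_integral[symmetric]) auto
    also have "\<dots> \<le> (\<integral>\<^sup>+ \<omega>. lifetime_sum k (complex_filtration (V n) (u n) \<omega>) \<partial>M n)"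
      using L(2) by (intro nn_integral_mono)
    finally show ?case by (simp add: mult_left_mono)
  qed
  then show "\<exists>C::real>0. \<forall>\<^sub>F n in sequentially.
            ennreal (real n ^ (k + 1) * Phi p k (1 / real n))
              \<le> ennreal C * (\<integral>\<^sup>+ \<omega>. lifetime_sum k (complex_filtration (V n) (u n) \<omega>) \<partial>M n)"
    using c(1) by (intro exI[of _ "1 / c"]) auto
qed

end
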